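(* Let $\mathcal{A}$ and $\mathcal{B}$ be compatible Poisson brackets on a manifold $M$, and let $v$ be a vector field on $M$ with $v=\mathcal{A}\,df=\mathcal{B}\,dg$ for some functions $f,g$. If $v$ is locally bi-integrable, then $v$ is tangent to the symplectic leaves of $\mathcal{A}_\lambda=\mathcal{A}+\lambda\mathcal{B}$ for a generic pair $(\lambda,x)\in\bar{\mathbb{C}}\times M$, i.e. for such pairs $$v(x)\in\operatorname{Im}\mathcal{A}_\lambda(x).$$
   Context: $M$ is a real $C^\infty$-smooth manifold ($\mathbb{K}=\mathbb{R}$) or a complex analytic manifold ($\mathbb{K}=\mathbb{C}$), and all objects are of the corresponding class. $\bar{\mathbb{K}}=\mathbb{K}\cup\{\infty\}$, $\bar{\mathbb{C}}=\mathbb{C}\cup\{\infty\}$, $\mathcal{A}_\infty=\mathcal{B}$. A Poisson bracket is identified with its bivector, viewed at each $x$ as a map $T_x^*M\to T_xM$; in the real case, for non-real $\lambda$, $\mathcal{A}_\lambda(x)$ acts on the complexified cotangent space with values in the complexified tangent space. A property holds "generically" or "almost everywhere" if it holds on an open dense subset. Poisson brackets $\mathcal{A},\mathcal{B}$ are compatible if all their constant-coefficient linear combinations are Poisson brackets; $\mathcal{P}=\{\mathcal{A}_\lambda\}_{\lambda\in\bar{\mathbb{K}}}$ is the Poisson pencil they generate. The rank of the pencil on $M$ is $\operatorname{rk}\mathcal{P}=\max_{x\in M,\ \lambda\in\bar{\mathbb{K}}}\operatorname{rk}\mathcal{A}_\lambda(x)$. Functions are in bi-involution if they pairwise commute with respect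 to all $\mathcal{A}_\lambda$. A set of integrals (functions $h$ with $v(h)=0$) in bi-involution is complete if it contains $N=\dim M-\frac12\operatorname{rk}\mathcal{P}$ functionally independent functions $f_1,\dots,f_N$, i.e. $df_1\wedge\dots\wedge df_N\ne0$ almost everywhere; here $\operatorname{rk}\mathcal{P}$ is the rank of the pencil on $M$. $v$ is locally bi-integrable if in a neighborhood of a generic point $x\in M$ there exists a complete set of integrals of $v$ in bi-involution.
   Formalization: In the real case it is additionally assumed that the maximum over λ of rk A_λ(x) equals rk P for x in an open dense subset of M, and in the complex case that M is connected; without these the claim, with rk P the maximum over all of M, is false. *)

theory Defs
  imports "HOL-Analysis.Analysis" "HOL-Combinatorics.Permutations"
begin

text \<open>
  Everything up to the complexification is written for an arbitrary field of scalars
  \<^typ>\<open>'k::real_normed_field\<close> and is used for the real numbers and for the complex numbers.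
  Manifolds are topological spaces with an atlas; tensor fields are given by their components in
  the charts of the atlas, subject to the usual transformation law.
\<close>

subsection \<open>Differentiability in coordinates\<close>

text \<open>
  The differential is required to be linear over the field of scalars.  For the reals,
  \<open>smooth_on\<close> is therefore \<open>C\<^sup>\<infinity>\<close>; for the complex numbers it says that the function and all its
  partial derivatives are complex differentiable, i.e. that it is holomorphic.
  The set \<open>S\<close> is always open in what follows.
\<close>

primrec Ck_on :: "nat \<Rightarrow> ('k::real_normed_field ^ 'n) set \<Rightarrow> ('k ^ 'n \<Rightarrow> 'k) \<Rightarrow> bool" where
  "Ck_on 0 S f \<longleftrightarrow> continuous_on S f"
| "Ck_on (Suc k) S f \<longleftrightarrow>
     (\<exists>g. (\<forall>y\<in>S. (f has_derivative (\<lambda>h. \<Sum>i\<in>UNIV. g i y * h $ i)) (at y)) \<and>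
          (\<forall>i. Ck_on k S (g i)))"

definition smooth_on :: "('k::real_normed_field ^ 'n) set \<Rightarrow> ('k ^ 'n \<Rightarrow> 'k) \<Rightarrow> bool" where
  "smooth_on S f \<longleftrightarrow> (\<forall>k. Ck_on k S f)"

subsection \<open>Manifolds\<close>

text \<open>A chart is its domain together with the coordinate map, whose values outside the domain
  are irrelevant.\<close>

type_synonym ('m, 'k, 'n) chart = "'m set \<times> ('m \<Rightarrow> 'k ^ 'n)"

definition chart_image :: "('m, 'k, 'n::finite) chart \<Rightarrow> 'm set \<Rightarrow> ('k ^ 'n) set" where
  "chart_image c U = snd c ` (U \<inter> fst c)"

definition chart_inv :: "('m, 'k, 'n::finite) chart \<Rightarrow> 'k ^ 'n \<Rightarrow> 'm" where
  "chart_inv c = inv_into (fst c) (snd c)"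

definition is_chart :: "'m topology \<Rightarrow> ('m, 'k::real_normed_field, 'n::finite) chart \<Rightarrow> bool" where
  "is_chart M c \<longleftrightarrow>
     openin M (fst c) \<and> open (snd c ` fst c) \<and>
     homeomorphic_map (subtopology M (fst c)) (top_of_set (snd c ` fst c)) (snd c)"

definition manifold ::
    "'m topology \<Rightarrow> ('m, 'k::real_normed_field, 'n::finite) chart set \<Rightarrow> bool" where
  "manifold M \<Phi> \<longleftrightarrow>
     Hausdorff_space M \<and> second_countable M \<and>
     (\<forall>c\<in>\<Phi>. is_chart M c) \<and>
     (\<Union>c\<in>\<Phi>. fst c) = topspace M \<and>
     (\<forall>c\<in>\<Phi>. \<forall>d\<in>\<Phi>. \<forall>i. smooth_on (chart_image c (fst d)) (\<lambda>y. snd d (chart_inv c y) $ i))"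

definition smooth_fun ::
    "('m, 'k::real_normed_field, 'n::finite) chart set \<Rightarrow> 'm set \<Rightarrow> ('m \<Rightarrow> 'k) \<Rightarrow> bool" where
  "smooth_fun \<Phi> U f \<longleftrightarrow> (\<forall>c\<in>\<Phi>. smooth_on (chart_image c U) (\<lambda>y. f (chart_inv c y)))"

definition generically :: "'a topology \<Rightarrow> ('a \<Rightarrow> bool) \<Rightarrow> bool" where
  "generically X P \<longleftrightarrow> (\<exists>G. openin X G \<and> X closure_of G = topspace X \<and> (\<forall>x\<in>G. P x))"

subsection \<open>Differentials, vector fields and bivectors\<close>

definition partial ::
    "('m, 'k::real_normed_field, 'n::finite) chart \<Rightarrow> 'n \<Rightarrow> ('m \<Rightarrow> 'k) \<Rightarrow> 'm \<Rightarrow> 'k" where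
  "partial c i f x = deriv (\<lambda>t. f (chart_inv c (snd c x + axis i t))) 0"

definition differential ::
    "('m, 'k::real_normed_field, 'n::finite) chart \<Rightarrow> ('m \<Rightarrow> 'k) \<Rightarrow> 'm \<Rightarrow> 'k ^ 'n" where
  "differential c f x = (\<chi> i. partial c i f x)"

text \<open>The Jacobian matrix at \<open>x\<close> of the change of coordinates from \<open>c\<close> to \<open>d\<close>.\<close>

definition jacobian ::
    "('m, 'k::real_normed_field, 'n::finite) chart \<Rightarrow> ('m, 'k, 'n) chart \<Rightarrow> 'm \<Rightarrow> 'k ^ 'n ^ 'n" where
  "jacobian c d x = (\<chi> i j. partial c j (\<lambda>y. snd d y $ i) x)"

text \<open>\<open>v c x\<close> is the column of components of the tangent vector \<open>v(x)\<close> in the chart \<open>c\<close>.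
  It is only meaningful for \<open>c\<close> in the atlas and \<open>x\<close> in the domain of \<open>c\<close>.\<close>

definition vector_field ::
    "('m, 'k::real_normed_field, 'n::finite) chart set
      \<Rightarrow> (('m, 'k, 'n) chart \<Rightarrow> 'm \<Rightarrow> 'k ^ 'n) \<Rightarrow> bool" where
  "vector_field \<Phi> v \<longleftrightarrow>
     (\<forall>c\<in>\<Phi>. \<forall>i. smooth_on (chart_image c (fst c)) (\<lambda>y. v c (chart_inv c y) $ i)) \<and>
     (\<forall>c\<in>\<Phi>. \<forall>d\<in>\<Phi>. \<forall>x\<in>fst c \<inter> fst d. v d x = jacobian c d x *v v c x)"

text \<open>Likewise, \<open>P c x\<close> is the matrix of the map from the cotangent to the tangent space at \<open>x\<close>
  given by the bivector \<open>P\<close>; in coordinates, this map is \<open>\<lambda>\<alpha>. P c x *v \<alpha>\<close>.\<close>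

definition bivector_field ::
    "('m, 'k::real_normed_field, 'n::finite) chart set
      \<Rightarrow> (('m, 'k, 'n) chart \<Rightarrow> 'm \<Rightarrow> 'k ^ 'n ^ 'n) \<Rightarrow> bool" where
  "bivector_field \<Phi> P \<longleftrightarrow>
     (\<forall>c\<in>\<Phi>. \<forall>i j. smooth_on (chart_image c (fst c)) (\<lambda>y. P c (chart_inv c y) $ i $ j)) \<and>
     (\<forall>c\<in>\<Phi>. \<forall>x\<in>fst c. \<forall>i j. P c x $ i $ j = - P c x $ j $ i) \<and>
     (\<forall>c\<in>\<Phi>. \<forall>d\<in>\<Phi>. \<forall>x\<in>fst c \<inter> fst d.
        P d x = jacobian c d x ** P c x ** transpose (jacobian c d x))"

definition bracket ::
    "('m, 'k::real_normed_field, 'n::finite) chart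
      \<Rightarrow> (('m, 'k, 'n) chart \<Rightarrow> 'm \<Rightarrow> 'k ^ 'n ^ 'n) \<Rightarrow> ('m \<Rightarrow> 'k) \<Rightarrow> ('m \<Rightarrow> 'k) \<Rightarrow> 'm \<Rightarrow> 'k" where
  "bracket c P f g x = (\<Sum>i\<in>UNIV. \<Sum>j\<in>UNIV. P c x $ i $ j * partial c i f x * partial c j g x)"

text \<open>The Jacobi identity is local, so it suffices to impose it on functions defined on open
  subsets of chart domains.\<close>

definition poisson ::
    "'m topology \<Rightarrow> ('m, 'k::real_normed_field, 'n::finite) chart set
      \<Rightarrow> (('m, 'k, 'n) chart \<Rightarrow> 'm \<Rightarrow> 'k ^ 'n ^ 'n) \<Rightarrow> bool" where
  "poisson M \<Phi> P \<longleftrightarrow>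
     bivector_field \<Phi> P \<and>
     (\<forall>c\<in>\<Phi>. \<forall>U f g h. openin M U \<and> U \<subseteq> fst c \<and>
        smooth_fun \<Phi> U f \<and> smooth_fun \<Phi> U g \<and> smooth_fun \<Phi> U h \<longrightarrow>
        (\<forall>x\<in>U. bracket c P f (bracket c P g h) x + bracket c P g (bracket c P h f) x
                + bracket c P h (bracket c P f g) x = 0))"

subsection \<open>Poisson pencils\<close>

text \<open>The type \<open>'c\<close> of charts is left arbitrary because the components of a real tensor field
  are complexified below while its charts stay real.\<close>

definition lin_comb ::
    "'k::field \<Rightarrow> ('c \<Rightarrow> 'm \<Rightarrow> 'k ^ 'n ^ 'n) \<Rightarrow> 'k \<Rightarrow> ('c \<Rightarrow> 'm \<Rightarrow> 'k ^ 'n ^ 'n)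
      \<Rightarrow> 'c \<Rightarrow> 'm \<Rightarrow> 'k ^ 'n ^ 'n" where
  "lin_comb a A b B c x = (\<chi> i j. a * A c x $ i $ j + b * B c x $ i $ j)"

definition compatible_poisson ::
    "'m topology \<Rightarrow> ('m, 'k::real_normed_field, 'n::finite) chart set
      \<Rightarrow> (('m, 'k, 'n) chart \<Rightarrow> 'm \<Rightarrow> 'k ^ 'n ^ 'n)
      \<Rightarrow> (('m, 'k, 'n) chart \<Rightarrow> 'm \<Rightarrow> 'k ^ 'n ^ 'n) \<Rightarrow> bool" where
  "compatible_poisson M \<Phi> A B \<longleftrightarrow>
     poisson M \<Phi> A \<and> poisson M \<Phi> B \<and> (\<forall>a b. poisson M \<Phi> (lin_comb a A b B))"

text \<open>The projective line of parameters is \<^typ>\<open>'k option\<close>, with \<^const>\<open>None\<close> as the point at infinity.\<close>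

definition pencil ::
    "('c \<Rightarrow> 'm \<Rightarrow> 'k::field ^ 'n ^ 'n) \<Rightarrow> ('c \<Rightarrow> 'm \<Rightarrow> 'k ^ 'n ^ 'n) \<Rightarrow> 'k option
      \<Rightarrow> 'c \<Rightarrow> 'm \<Rightarrow> 'k ^ 'n ^ 'n" where
  "pencil A B l = (case l of Some t \<Rightarrow> lin_comb 1 A t B | None \<Rightarrow> B)"

definition pencil_rank ::
    "('m, 'k::real_normed_field, 'n::finite) chart set
      \<Rightarrow> (('m, 'k, 'n) chart \<Rightarrow> 'm \<Rightarrow> 'k ^ 'n ^ 'n)
      \<Rightarrow> (('m, 'k, 'n) chart \<Rightarrow> 'm \<Rightarrow> 'k ^ 'n ^ 'n) \<Rightarrow> nat" where
  "pencil_rank \<Phi> A B = Max {rank (pencil A B l c x) | l c x. c \<in> \<Phi> \<and> x \<in> fst c}"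

text \<open>The maximum over \<open>l\<close> of the rank at \<open>x\<close> equals the rank of the pencil for generic \<open>x\<close>.
  On a connected complex manifold this is automatic.  In the \<open>C\<^sup>\<infinity>\<close> class it can fail, and then the
  number of integrals required for completeness is too small over the open set of lower rank.\<close>

definition rank_attained_generically ::
    "'m topology \<Rightarrow> ('m, 'k::real_normed_field, 'n::finite) chart set
      \<Rightarrow> (('m, 'k, 'n) chart \<Rightarrow> 'm \<Rightarrow> 'k ^ 'n ^ 'n)
      \<Rightarrow> (('m, 'k, 'n) chart \<Rightarrow> 'm \<Rightarrow> 'k ^ 'n ^ 'n) \<Rightarrow> bool" where
  "rank_attained_generically M \<Phi> A B \<longleftrightarrow>
     generically M (\<lambda>x. \<exists>l. \<forall>c\<in>\<Phi>. x \<in> fst c \<longrightarrow> rank (pencil A B l c x) = pencil_rank \<Phi> A B)"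

definition hamiltonian_field ::
    "('m, 'k::real_normed_field, 'n::finite) chart set
      \<Rightarrow> (('m, 'k, 'n) chart \<Rightarrow> 'm \<Rightarrow> 'k ^ 'n ^ 'n) \<Rightarrow> ('m \<Rightarrow> 'k)
      \<Rightarrow> (('m, 'k, 'n) chart \<Rightarrow> 'm \<Rightarrow> 'k ^ 'n) \<Rightarrow> bool" where
  "hamiltonian_field \<Phi> P f v \<longleftrightarrow> (\<forall>c\<in>\<Phi>. \<forall>x\<in>fst c. v c x = P c x *v differential c f x)"

subsection \<open>Local bi-integrability\<close>

definition integral_of ::
    "('m, 'k::real_normed_field, 'n::finite) chart set
      \<Rightarrow> (('m, 'k, 'n) chart \<Rightarrow> 'm \<Rightarrow> 'k ^ 'n) \<Rightarrow> 'm set \<Rightarrow> ('m \<Rightarrow> 'k) \<Rightarrow> bool" where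
  "integral_of \<Phi> v U h \<longleftrightarrow>
     smooth_fun \<Phi> U h \<and> (\<forall>c\<in>\<Phi>. \<forall>x\<in>U \<inter> fst c. (\<Sum>i\<in>UNIV. v c x $ i * partial c i h x) = 0)"

definition in_bi_involution ::
    "('m, 'k::real_normed_field, 'n::finite) chart set
      \<Rightarrow> (('m, 'k, 'n) chart \<Rightarrow> 'm \<Rightarrow> 'k ^ 'n ^ 'n)
      \<Rightarrow> (('m, 'k, 'n) chart \<Rightarrow> 'm \<Rightarrow> 'k ^ 'n ^ 'n) \<Rightarrow> 'm set \<Rightarrow> ('m \<Rightarrow> 'k) set \<Rightarrow> bool" where
  "in_bi_involution \<Phi> A B U F \<longleftrightarrow>
     (\<forall>h1\<in>F. \<forall>h2\<in>F. \<forall>l. \<forall>c\<in>\<Phi>. \<forall>x\<in>U \<inter> fst c. bracket c (pencil A B l) h1 h2 x = 0)"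

text \<open>The value of the alternating form \<open>\<alpha>\<^sub>0 \<and> \<dots> \<and> \<alpha>\<^sub>N\<^sub>-\<^sub>1\<close> on the vectors
  \<open>X\<^sub>0, \<dots>, X\<^sub>N\<^sub>-\<^sub>1\<close>, i.e. the determinant of the matrix of the \<open>\<alpha>\<^sub>i(X\<^sub>j)\<close>.\<close>

definition wedge ::
    "nat \<Rightarrow> (nat \<Rightarrow> 'k::field ^ 'n::finite) \<Rightarrow> (nat \<Rightarrow> 'k ^ 'n) \<Rightarrow> 'k" where
  "wedge N \<alpha> X =
     (\<Sum>p | p permutes {..<N}. of_int (sign p) * (\<Prod>i<N. \<Sum>j\<in>UNIV. \<alpha> i $ j * X (p i) $ j))"

definition functionally_independent ::
    "'m topology \<Rightarrow> ('m, 'k::real_normed_field, 'n::finite) chart set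
      \<Rightarrow> 'm set \<Rightarrow> nat \<Rightarrow> (nat \<Rightarrow> 'm \<Rightarrow> 'k) \<Rightarrow> bool" where
  "functionally_independent M \<Phi> U N fs \<longleftrightarrow>
     generically (subtopology M U)
       (\<lambda>x. \<forall>c\<in>\<Phi>. x \<in> fst c \<longrightarrow> wedge N (\<lambda>i. differential c (fs i) x) \<noteq> (\<lambda>X. 0))"

text \<open>The division by two is exact, because skew-symmetric matrices have even rank.\<close>

definition complete_on ::
    "'m topology \<Rightarrow> ('m, 'k::real_normed_field, 'n::finite) chart set
      \<Rightarrow> (('m, 'k, 'n) chart \<Rightarrow> 'm \<Rightarrow> 'k ^ 'n ^ 'n)
      \<Rightarrow> (('m, 'k, 'n) chart \<Rightarrow> 'm \<Rightarrow> 'k ^ 'n ^ 'n) \<Rightarrow> 'm set \<Rightarrow> ('m \<Rightarrow> 'k) set \<Rightarrow> bool" where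
  "complete_on M \<Phi> A B U F \<longleftrightarrow>
     (let N = CARD('n) - pencil_rank \<Phi> A B div 2
      in \<exists>fs. (\<forall>i<N. fs i \<in> F) \<and> functionally_independent M \<Phi> U N fs)"

definition locally_bi_integrable ::
    "'m topology \<Rightarrow> ('m, 'k::real_normed_field, 'n::finite) chart set
      \<Rightarrow> (('m, 'k, 'n) chart \<Rightarrow> 'm \<Rightarrow> 'k ^ 'n ^ 'n)
      \<Rightarrow> (('m, 'k, 'n) chart \<Rightarrow> 'm \<Rightarrow> 'k ^ 'n ^ 'n)
      \<Rightarrow> (('m, 'k, 'n) chart \<Rightarrow> 'm \<Rightarrow> 'k ^ 'n) \<Rightarrow> bool" where
  "locally_bi_integrable M \<Phi> A B v \<longleftrightarrow>
     generically M (\<lambda>x. \<exists>U F. openin M U \<and> x \<in> U \<and>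
       (\<forall>h\<in>F. integral_of \<Phi> v U h) \<and> in_bi_involution \<Phi> A B U F \<and> complete_on M \<Phi> A B U F)"

subsection \<open>Complexification and the Riemann sphere\<close>

definition cvec :: "('c \<Rightarrow> 'm \<Rightarrow> real ^ 'n) \<Rightarrow> 'c \<Rightarrow> 'm \<Rightarrow> complex ^ 'n" where
  "cvec v c x = (\<chi> i. complex_of_real (v c x $ i))"

definition cmat :: "('c \<Rightarrow> 'm \<Rightarrow> real ^ 'n ^ 'n) \<Rightarrow> 'c \<Rightarrow> 'm \<Rightarrow> complex ^ 'n ^ 'n" where
  "cmat P c x = (\<chi> i j. complex_of_real (P c x $ i $ j))"

abbreviation riemann_sphere :: "complex option topology" where
  "riemann_sphere \<equiv> Alexandroff_compactification euclidean"

definition in_image ::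
    "('m, 'k::real_normed_field, 'n::finite) chart set
      \<Rightarrow> (('m, 'k, 'n) chart \<Rightarrow> 'm \<Rightarrow> complex ^ 'n)
      \<Rightarrow> (('m, 'k, 'n) chart \<Rightarrow> 'm \<Rightarrow> complex ^ 'n ^ 'n) \<Rightarrow> 'm \<Rightarrow> bool" where
  "in_image \<Phi> v P x \<longleftrightarrow> (\<forall>c\<in>\<Phi>. x \<in> fst c \<longrightarrow> v c x \<in> range (\<lambda>\<alpha>. P c x *v \<alpha>))"

end

theory Submission
  imports Defs "HOL-Complex_Analysis.Conformal_Mappings"
begin

text \<open>
  At a generic point \<open>x\<close> the differentials of a complete set of integrals span a subspace \<open>L\<close> of
  dimension \<open>n - r div 2\<close>, where \<open>r\<close> is the rank of the pencil, and \<open>L\<close> is isotropic for \<open>A\<close> and \<open>B\<close>,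
  hence for every complex combination of them.  Whenever \<open>A + \<lambda>B\<close> has rank at least \<open>r\<close> at \<open>x\<close>, the
  dimension makes \<open>L\<close> maximal isotropic, so \<open>L\<close> contains the kernel of \<open>A + \<lambda>B\<close>.  As \<open>v\<close> is annihilated
  by \<open>L\<close>, it is annihilated by this kernel, i.e. it lies in the image of the skew map \<open>A + \<lambda>B\<close>.
  The rank condition is open in \<open>(\<lambda>, x)\<close>; for generic \<open>x\<close> some determinant bounding the
  rank from below is a nonzero polynomial in \<open>\<lambda>\<close>, so the condition holds on a dense set.
\<close>

subsection \<open>Isotropic subspaces of skew-symmetric matrices\<close>

text \<open>Vectors and covectors share one coordinate type, so the dual pairing becomes the
  bilinear dot product, without conjugation over the complex numbers. One operation then serves for
  duality in both directions.\<close>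

definition annihilator :: "('a::field ^ 'n) set \<Rightarrow> ('a ^ 'n) set" where
  "annihilator S = {y. \<forall>x\<in>S. (\<Sum>i\<in>UNIV. x $ i * y $ i) = 0}"

lemma annihilator_antimono: "S \<subseteq> T \<Longrightarrow> annihilator T \<subseteq> annihilator S"
  by (auto simp: annihilator_def)

lemma subset_annihilator_annihilator: "S \<subseteq> annihilator (annihilator S)"
  by (auto simp: annihilator_def mult.commute)

lemma subspace_annihilator: "vec.subspace (annihilator S)"
  by (auto simp: vec.subspace_def annihilator_def distrib_left sum.distrib
      sum_distrib_left[symmetric] mult.left_commute)

lemma annihilator_span: "annihilator (vec.span S) = annihilator S"
proof
  show "annihilator (vec.span S) \<subseteq> annihilator S"
    by (intro annihilator_antimono vec.span_superset)
  have "vec.span S \<subseteq> annihilator (annihilator S)"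
    by (intro vec.span_minimal subset_annihilator_annihilator subspace_annihilator)
  then show "annihilator S \<subseteq> annihilator (vec.span S)"
    using subset_annihilator_annihilator annihilator_antimono by blast
qed

text \<open>Injectivity has to be stated separately, because the set of rows forgets
  repetitions.\<close>

lemma det_nonzero_iff_independent_rows:
  fixes Q :: "'a::field ^ 'n ^ 'n"
  shows "det Q \<noteq> 0 \<longleftrightarrow> inj (($) Q) \<and> vec.independent (range (($) Q))"
proof -
  have rows: "rows Q = range (($) Q)"
    by (auto simp: rows_def row_def)
  show ?thesis
  proof
    assume nz: "det Q \<noteq> 0"
    have "inj (($) Q)"
    proof (rule injI)
      fix i j assume "Q $ i = Q $ j"
      then show "i = j"
        using nz det_identical_rows[of i j Q] by (auto simp: row_def)
    qed
    then show "inj (($) Q) \<and> vec.independent (range (($) Q))"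
      using nz det_dependent_rows[of Q] rows by auto
  next
    assume a: "inj (($) Q) \<and> vec.independent (range (($) Q))"
    then have "vec.dim (range (($) Q)) = CARD('n)"
      by (simp add: vec.dim_eq_card_independent card_image)
    then have "vec.span (rows Q) = UNIV"
      unfolding rows by (simp add: vec.dim_eq_full[symmetric] vec.dimension_def card_cart_basis)
    then have "invertible Q"
      unfolding invertible_left_inverse by (simp add: matrix_left_invertible_span_rows_gen)
    then show "det Q \<noteq> 0"
      by (simp add: invertible_det_nz)
  qed
qed

text \<open>A basis extending the given vectors has exactly as many further elements as there are
  free row positions, and any bijection between the two fills the matrix.\<close>

lemma extend_independent_rows:
  fixes r :: "'n::finite \<Rightarrow> 'a::field ^ 'n"
  assumes "inj_on r I" "vec.independent (r ` I)"
  shows "\<exists>Q :: 'a ^ 'n ^ 'n. det Q \<noteq> 0 \<and> (\<forall>i\<in>I. Q $ i = r i)"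
proof -
  obtain B where B: "r ` I \<subseteq> B" "vec.independent B" "vec.span B = UNIV"
    using vec.maximal_independent_subset_extend[OF subset_UNIV assms(2)] by (metis UNIV_eq_I subsetD UNIV_I)
  have finB: "finite B"
    using B(2) by (rule vec.finiteI_independent)
  have cardB: "card B = CARD('n)"
    using B by (metis vec.dim_eq_card_independent vec.dim_span vec_dim_card)
  have "card (B - r ` I) = card (UNIV - I)"
    using B(1) assms(1) cardB finB
    by (simp add: card_Diff_subset finite_subset card_image)
  then obtain h where h: "bij_betw h (UNIV - I) (B - r ` I)"
    using finB by (metis finite_Diff finite finite_same_card_bij)
  define Q :: "'a ^ 'n ^ 'n" where "Q = (\<chi> i. if i \<in> I then r i else h i)"
  have Q: "($) Q = (\<lambda>i. if i \<in> I then r i else h i)"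
    by (auto simp: Q_def)
  have hm: "h i \<in> B - r ` I" if "i \<notin> I" for i
    using h that by (auto simp: bij_betw_def)
  have "inj (($) Q)"
  proof (rule injI)
    fix i j assume eq: "Q $ i = Q $ j"
    consider "i \<in> I" "j \<in> I" | "i \<in> I" "j \<notin> I" | "i \<notin> I" "j \<in> I" | "i \<notin> I" "j \<notin> I"
      by blast
    then show "i = j"
    proof cases
      case 1
      then show ?thesis
        using eq assms(1) by (simp add: Q inj_on_eq_iff)
    next
      case 2
      then show ?thesis
        using eq hm[of j] by (simp add: Q) (metis imageI)
    next
      case 3
      then show ?thesis
        using eq hm[of i] by (auto simp: Q)
    next
      case 4
      then show ?thesis
        using eq bij_betw_imp_inj_on[OF h] by (simp add: Q inj_on_eq_iff)
    qed
  qed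
  moreover have "range (($) Q) \<subseteq> B"
    using B(1) hm by (auto simp: Q)
  ultimately have "det Q \<noteq> 0"
    unfolding det_nonzero_iff_independent_rows
    using B(2) vec.independent_mono by blast
  then show ?thesis
    by (auto simp: Q_def)
qed

text \<open>A basis of \<open>S\<close> is placed into the rows \<open>I\<close> of an invertible
  matrix \<open>Q\<close>. In the coordinates \<open>Q *v y\<close> the annihilator is the
  coordinate subspace where the entries indexed by \<open>I\<close> vanish, and its dimension is
  known.\<close>

lemma dim_annihilator:
  fixes S :: "('a::field ^ 'n) set"
  shows "vec.dim (annihilator S) + vec.dim S = CARD('n)"
proof -
  obtain B where B: "B \<subseteq> S" "vec.independent B" "S \<subseteq> vec.span B" "card B = vec.dim S"
    using vec.basis_exists by metis
  have finB: "finite B"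
    using B(2) by (rule vec.finiteI_independent)
  have "card B \<le> CARD('n)"
    using B(4) dim_subset_UNIV_cart_gen by metis
  then obtain I :: "'n set" where I: "card I = card B"
    by (meson obtain_subset_with_card_n)
  then obtain r where r: "bij_betw r I B"
    using finB by (metis finite finite_same_card_bij)
  obtain Q :: "'a ^ 'n ^ 'n" where Q: "det Q \<noteq> 0" "\<forall>i\<in>I. Q $ i = r i"
    using extend_independent_rows[of r I] r B(2) by (auto simp: bij_betw_def)
  have "vec.span S = vec.span B"
    using B by (metis vec.span_minimal vec.span_mono vec.subspace_span subset_antisym)
  then have "annihilator S = annihilator (r ` I)"
    using r by (metis annihilator_span bij_betw_def)
  also have "\<dots> = {y. \<forall>i. i \<notin> UNIV - I \<longrightarrow> (Q *v y) $ i = 0}"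
    using Q by (auto simp: annihilator_def matrix_vector_mult_def)
  finally have ann: "annihilator S = {y. \<forall>i. i \<notin> UNIV - I \<longrightarrow> (Q *v y) $ i = 0}" .
  obtain Q' where Q': "Q ** Q' = mat 1" "Q' ** Q = mat 1"
    using Q(1) by (auto simp: invertible_det_nz[symmetric] invertible_def)
  have inv: "Q *v (Q' *v x) = x" "Q' *v (Q *v x) = x" for x
    using Q' by (simp_all add: matrix_vector_mul_assoc)
  let ?E = "{x :: 'a ^ 'n. \<forall>i. i \<notin> UNIV - I \<longrightarrow> x $ i = 0}"
  have "annihilator S = (*v) Q' ` ?E"
  proof (intro set_eqI iffI)
    fix y assume "y \<in> annihilator S"
    then have "Q *v y \<in> ?E"
      unfolding ann by blast
    then have "Q' *v (Q *v y) \<in> (*v) Q' ` ?E"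
      by (rule imageI)
    then show "y \<in> (*v) Q' ` ?E"
      by (simp only: inv(2))
  next
    fix y assume "y \<in> (*v) Q' ` ?E"
    then show "y \<in> annihilator S"
      unfolding ann using inv(1) by auto
  qed
  moreover have "inj_on ((*v) Q') (vec.span ?E)"
    using inv(1) by (rule inj_on_inverseI)
  ultimately have "vec.dim (annihilator S) = vec.dim ?E"
    by (simp add: vec.dim_image_eq)
  also have "\<dots> = card (UNIV - I)"
    by (rule dim_substandard_cart)
  also have "\<dots> = CARD('n) - vec.dim S"
    using I B(4) by (simp add: card_Diff_subset)
  finally show ?thesis
    using dim_subset_UNIV_cart_gen[of S] by simp
qed

text \<open>One inclusion is immediate, and the dimension formula applied twice makes it an
  equality.\<close>

lemma annihilator_annihilator: "annihilator (annihilator S) = vec.span S"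
proof (rule sym, rule vec.subspace_dim_equal)
  show "vec.span S \<subseteq> annihilator (annihilator S)"
    by (intro vec.span_minimal subset_annihilator_annihilator subspace_annihilator)
  show "vec.dim (annihilator (annihilator S)) \<le> vec.dim (vec.span S)"
    using dim_annihilator[of S] dim_annihilator[of "annihilator S"] by simp
qed (simp_all add: subspace_annihilator)

lemma kernel_eq_annihilator_rows: "{x. P *v x = 0} = annihilator (rows P)"
  by (auto simp: annihilator_def rows_def row_def matrix_vector_mult_def vec_eq_iff)

text \<open>This is the inequality of rank-nullity for the restriction of \<open>f\<close> to a
  subspace: a basis \<open>B\<close> of the kernel in \<open>S\<close> is extended to a basis
  \<open>C\<close> of \<open>S\<close>, and \<open>f\<close> is injective on the span of
  \<open>C - B\<close>.\<close>

lemma dim_le_dim_kernel_plus_dim_image: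
  fixes f :: "'a::field ^ 'n \<Rightarrow> 'a ^ 'm"
  assumes f: "Vector_Spaces.linear (*s) (*s) f" and S: "vec.subspace S"
  shows "vec.dim S \<le> vec.dim (S \<inter> {x. f x = 0}) + vec.dim (f ` S)"
proof -
  interpret f: Vector_Spaces.linear "(*s)" "(*s)" f by fact
  let ?K = "S \<inter> {x. f x = 0}"
  obtain B where B: "B \<subseteq> ?K" "vec.independent B" "?K \<subseteq> vec.span B" "card B = vec.dim ?K"
    using vec.basis_exists by metis
  obtain C where C: "B \<subseteq> C" "C \<subseteq> S" "vec.independent C" "S \<subseteq> vec.span C"
    using vec.maximal_independent_subset_extend[of B S] B by blast
  have fin: "finite C"
    using C(3) by (rule vec.finiteI_independent)
  have dimS: "vec.dim S = card C"
    using C by (metis vec.basis_card_eq_dim)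
  have ind: "vec.independent (C - B)"
    using C(3) vec.independent_mono by blast
  \<comment> \<open>The dimension formula for sums of subspaces is read backwards: the sum has the
    full dimension \<open>card C\<close>, so the two spans intersect trivially.\<close>
  have "vec.dim {x + y |x y. x \<in> vec.span B \<and> y \<in> vec.span (C - B)} = card C"
    using C(1,3) vec.span_Un[of B "C - B"]
    by (metis Un_Diff_cancel sup.absorb2 vec.dim_eq_card_independent vec.dim_span)
  moreover have "card B + card (C - B) = card C"
    using C(1) fin by (metis card_Diff_subset card_mono finite_subset le_add_diff_inverse)
  ultimately have "vec.dim (vec.span B \<inter> vec.span (C - B)) = 0"
    using vec.dim_sums_Int[of "vec.span B" "vec.span (C - B)"] ind B(2)
    by (simp add: vec.dim_eq_card_independent)
  then have triv: "vec.span B \<inter> vec.span (C - B) \<subseteq> {0}"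
    by (simp add: vec.dim_eq_0)
  have "inj_on f (vec.span (C - B))"
  proof (subst f.inj_on_iff_eq_0)
    show "\<forall>x\<in>vec.span (C - B). f x = 0 \<longrightarrow> x = 0"
    proof (intro ballI impI)
      fix x assume x: "x \<in> vec.span (C - B)" "f x = 0"
      then have "x \<in> S"
        using vec.span_minimal[OF _ S, of "C - B"] C(2) by blast
      then show "x = 0"
        using x triv B(3) by auto
    qed
  qed simp
  then have "vec.dim (f ` (C - B)) = card (C - B)"
    using f ind by (simp add: vec.dim_image_eq vec.dim_eq_card_independent)
  moreover have "vec.dim (f ` (C - B)) \<le> vec.dim (f ` S)"
    using C(2) by (intro vec.dim_subset) auto
  ultimately show ?thesis
    using dimS B(4) \<open>card B + card (C - B) = card C\<close> by simp
qed

text \<open>Isotropy puts the image of \<open>L\<close> under \<open>P\<close> into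
  \<open>annihilator L\<close>, of dimension n - dim L. So the kernel of \<open>P\<close> meets
  \<open>L\<close> in dimension at least 2 dim L - n, which by \<open>dim\<close> is at least the
  dimension of the kernel. Hence \<open>L\<close> contains the kernel, and passing to annihilators
  turns this into a statement about the row space of \<open>P\<close>.\<close>

lemma annihilator_isotropic_subset_range:
  fixes P :: "'a::field ^ 'n ^ 'n"
  assumes skew: "\<And>i j. P $ i $ j = - P $ j $ i"
    and L: "vec.subspace L"
    and iso: "\<And>x y. x \<in> L \<Longrightarrow> y \<in> L \<Longrightarrow> P *v y \<in> annihilator {x}"
    and dim: "2 * CARD('n) \<le> 2 * vec.dim L + rank P"
  shows "annihilator L \<subseteq> range ((*v) P)"
proof -
  let ?K = "{x. P *v x = 0}"
  have dimK: "vec.dim ?K + rank P = CARD('n)"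
    using dim_annihilator[of "rows P"] by (simp add: kernel_eq_annihilator_rows row_rank_def_gen)
  have "(*v) P ` L \<subseteq> annihilator L"
    using iso by (auto simp: annihilator_def)
  then have "vec.dim ((*v) P ` L) \<le> vec.dim (annihilator L)"
    by (rule vec.dim_subset)
  moreover have "vec.dim L \<le> vec.dim (L \<inter> ?K) + vec.dim ((*v) P ` L)"
    using L by (intro dim_le_dim_kernel_plus_dim_image) auto
  ultimately have "vec.dim ?K \<le> vec.dim (L \<inter> ?K)"
    using dim dimK dim_annihilator[of L] by linarith
  moreover have sub: "vec.subspace ?K"
    by (simp add: kernel_eq_annihilator_rows subspace_annihilator)
  ultimately have "L \<inter> ?K = ?K"
    using L by (intro vec.subspace_dim_equal vec.subspace_inter) auto
  then have "annihilator L \<subseteq> annihilator ?K"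
    by (intro annihilator_antimono) auto
  also have "\<dots> = vec.span (rows P)"
    by (simp add: kernel_eq_annihilator_rows annihilator_annihilator)
  also have "\<dots> \<subseteq> range ((*v) P)"
  proof (rule vec.span_minimal)
    \<comment> \<open>By skew symmetry row \<open>i\<close> is minus column \<open>i\<close>, so the
      row space lies in the image.\<close>
    have "row i P = P *v (- axis i 1)" for i
      using skew[of i]
      by (auto simp: row_def matrix_vector_mult_def vec_eq_iff axis_def if_distrib sum_negf cong: if_cong)
    then show "rows P \<subseteq> range ((*v) P)"
      by (auto simp: rows_def)
    show "vec.subspace (range ((*v) P))"
      by (intro vec.subspace_image) auto
  qed
  finally show ?thesis .
qed

subsection \<open>Rank and determinants\<close>

lemma rank_mult_le_right: "rank ((A :: 'a::field ^ 'm ^ 'l) ** (B :: 'a ^ 'n ^ 'm)) \<le> rank B"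
proof -
  have "rows (A ** B) \<subseteq> vec.span (rows B)"
  proof -
    have "row i (A ** B) = (\<Sum>k\<in>UNIV. A $ i $ k *s row k B)" for i
      by (simp add: vec_eq_iff row_def matrix_matrix_mult_def)
    moreover have "row k B \<in> rows B" for k
      by (auto simp: rows_def)
    ultimately show ?thesis
      by (auto simp: rows_def[of "A ** B"] intro!: vec.span_sum vec.span_scale intro: vec.span_base)
  qed
  then show ?thesis
    unfolding row_rank_def_gen by (metis vec.dim_subset vec.dim_span)
qed

lemma rank_mult_le_left: "rank ((A :: 'a::field ^ 'm ^ 'l) ** (B :: 'a ^ 'n ^ 'm)) \<le> rank A"
proof -
  have "rows (A ** B) = (*v) (transpose B) ` rows A"
  proof -
    have "row i (A ** B) = transpose B *v row i A" for i
      by (simp add: vec_eq_iff row_def matrix_matrix_mult_def matrix_vector_mult_def transpose_def mult.commute)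
    then show ?thesis
      by (auto simp: rows_def)
  qed
  then show ?thesis
    unfolding row_rank_def_gen using vec.dim_image_le[OF matrix_vector_mul_linear_gen] by metis
qed

text \<open>Bivectors change by congruence with the Jacobian. As \<open>J\<close> is not assumed
  invertible, only an inequality results; exchanging the two charts gives its converse.\<close>

lemma rank_congruence_le:
  fixes P :: "'a::field ^ 'n ^ 'n"
  shows "rank (J ** P ** transpose J) \<le> rank P"
  using rank_mult_le_left rank_mult_le_right le_trans by metis

text \<open>The determinant of this matrix plays the role of a minor on the rows \<open>I\<close>:
  the filling \<open>E\<close> keeps the matrix square of the original size, so no type of
  submatrices is involved.\<close>

definition replace_rows :: "'n set \<Rightarrow> 'a ^ 'n ^ 'n \<Rightarrow> 'a ^ 'n ^ 'n \<Rightarrow> 'a ^ 'n::finite ^ 'n" where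
  "replace_rows I E P = (\<chi> i. if i \<in> I then P $ i else E $ i)"

text \<open>Expressing a lower bound on the rank by a single determinant makes it visibly an open
  condition, stable under complexification and accessible to the identity theorem.\<close>

lemma rank_ge_iff_det_replace_rows:
  fixes P :: "'a::field ^ 'n ^ 'n"
  shows "r \<le> rank P \<longleftrightarrow> (\<exists>I E. r \<le> card I \<and> det (replace_rows I E P) \<noteq> 0)"
proof
  assume r: "r \<le> rank P"
  have rows: "rows P = range (($) P)"
    by (auto simp: rows_def row_def)
  obtain B where B: "B \<subseteq> range (($) P)" "vec.independent B" "card B = rank P"
    unfolding row_rank_def_gen rows using vec.basis_exists by metis
  \<comment> \<open>One index is chosen for each basis row, so that \<open>card I\<close> is the
    rank.\<close>
  then obtain I where I: "inj_on (($) P) I" "B = ($) P ` I"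
    unfolding subset_image_inj by blast
  then obtain Q where Q: "det Q \<noteq> 0" "\<forall>i\<in>I. Q $ i = P $ i"
    using extend_independent_rows[of "($) P" I] B(2) by blast
  then have "replace_rows I Q P = Q"
    by (simp add: replace_rows_def vec_eq_iff)
  moreover have "r \<le> card I"
    using r B(3) I by (simp add: card_image)
  ultimately show "\<exists>I E. r \<le> card I \<and> det (replace_rows I E P) \<noteq> 0"
    using Q(1) by metis
next
  assume "\<exists>I E. r \<le> card I \<and> det (replace_rows I E P) \<noteq> 0"
  then obtain I E where I: "r \<le> card I" and nz: "det (replace_rows I E P) \<noteq> 0"
    by blast
  let ?Q = "replace_rows I E P"
  have eq: "($) P ` I = ($) ?Q ` I"
    by (auto simp: replace_rows_def image_iff)
  have "inj_on (($) ?Q) I" "vec.independent (($) ?Q ` I)"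
    using nz vec.independent_mono[of "range (($) ?Q)" "($) ?Q ` I"]
    by (auto simp: det_nonzero_iff_independent_rows intro: inj_on_subset)
  then have "card I \<le> vec.dim (($) P ` I)"
    unfolding eq by (simp add: vec.dim_eq_card_independent card_image)
  also have "\<dots> \<le> rank P"
    unfolding row_rank_def_gen by (intro vec.dim_subset) (auto simp: rows_def row_def)
  finally show "r \<le> rank P"
    using I by simp
qed

text \<open>A determinant witnessing the real rank stays nonzero when its entries are read as
  complex numbers.\<close>

lemma rank_le_rank_complexification:
  fixes P :: "real ^ 'n ^ 'n"
  shows "rank P \<le> rank (\<chi> i j. complex_of_real (P $ i $ j))"
proof -
  obtain I E where I: "rank P \<le> card I" "det (replace_rows I E P) \<noteq> 0"
    using rank_ge_iff_det_replace_rows[of "rank P" P] by blast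
  have "replace_rows I (\<chi> i j. complex_of_real (E $ i $ j)) (\<chi> i j. complex_of_real (P $ i $ j))
      = (\<chi> i j. complex_of_real (replace_rows I E P $ i $ j))"
    by (simp add: replace_rows_def vec_eq_iff)
  moreover have "det (\<chi> i j. complex_of_real (Q $ i $ j)) = complex_of_real (det Q)" for Q :: "real ^ 'n ^ 'n"
    by (simp add: det_def)
  ultimately have "det (replace_rows I (\<chi> i j. complex_of_real (E $ i $ j)) (\<chi> i j. complex_of_real (P $ i $ j))) \<noteq> 0"
    using I(2) by simp
  then show ?thesis
    unfolding rank_ge_iff_det_replace_rows[of "rank P"] using I(1) by blast
qed

section \<open>Linear independence from a nonzero exterior product\<close>

lemma wedge_fun_upd:
  assumes "k < N"
  shows "wedge N (\<alpha>(k := \<beta>)) X =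
    (\<Sum>p | p permutes {..<N}. of_int (sign p) * (\<Prod>i\<in>{..<N} - {k}. \<Sum>j\<in>UNIV. \<alpha> i $ j * X (p i) $ j)
       * (\<Sum>j\<in>UNIV. \<beta> $ j * X (p k) $ j))"
  unfolding wedge_def
proof (rule sum.cong)
  fix p
  \<comment> \<open>Only factor \<open>k\<close> sees \<open>\<beta>\<close>. Once it is split off,
    linearity in that slot is visible.\<close>
  have "(\<Prod>i<N. \<Sum>j\<in>UNIV. (\<alpha>(k := \<beta>)) i $ j * X (p i) $ j)
      = (\<Sum>j\<in>UNIV. \<beta> $ j * X (p k) $ j)
        * (\<Prod>i\<in>{..<N} - {k}. \<Sum>j\<in>UNIV. (\<alpha>(k := \<beta>)) i $ j * X (p i) $ j)"
    using assms by (subst prod.remove[of _ k]) auto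
  also have "(\<Prod>i\<in>{..<N} - {k}. \<Sum>j\<in>UNIV. (\<alpha>(k := \<beta>)) i $ j * X (p i) $ j)
      = (\<Prod>i\<in>{..<N} - {k}. \<Sum>j\<in>UNIV. \<alpha> i $ j * X (p i) $ j)"
    by (rule prod.cong) auto
  finally show "of_int (sign p) * (\<Prod>i<N. \<Sum>j\<in>UNIV. (\<alpha>(k := \<beta>)) i $ j * X (p i) $ j)
      = of_int (sign p) * (\<Prod>i\<in>{..<N} - {k}. \<Sum>j\<in>UNIV. \<alpha> i $ j * X (p i) $ j)
       * (\<Sum>j\<in>UNIV. \<beta> $ j * X (p k) $ j)"
    by (simp add: mult.assoc mult.commute[of "sum _ _"])
qed simp

text \<open>Composing every permutation with the transposition of \<open>k\<close> and
  \<open>l\<close> reverses the sign of its term and permutes the summands, so the sum equals its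
  own negative. Characteristic zero then makes it vanish.\<close>

lemma wedge_eq_0_if_repeated:
  fixes \<alpha> :: "nat \<Rightarrow> 'a::field_char_0 ^ 'n"
  assumes kl: "k < N" "l < N" "k \<noteq> l" and eq: "\<alpha> k = \<alpha> l"
  shows "wedge N \<alpha> X = 0"
proof -
  let ?S = "{p. p permutes {..<N}}" and ?\<tau> = "Transposition.transpose k l"
  define f where "f p = of_int (sign p) * (\<Prod>i<N. \<Sum>j\<in>UNIV. \<alpha> i $ j * X (p i) $ j)" for p
  have \<tau>: "?\<tau> permutes {..<N}"
    using kl by (simp add: permutes_swap_id)
  have f: "f (p \<circ> ?\<tau>) = - f p" if "p \<in> ?S" for p
  proof -
    have "permutation p"
      using that permutation_permutes by blast
    then have sgn: "sign (p \<circ> ?\<tau>) = - sign p"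
      using kl(3) by (simp add: sign_compose permutation_swap_id sign_swap_id)
    \<comment> \<open>Since \<open>\<alpha> k = \<alpha> l\<close>, the transposition may also be
      inserted into the index of \<open>\<alpha>\<close>; reindexing the product then removes it
      from both places.\<close>
    have "(\<Prod>i<N. \<Sum>j\<in>UNIV. \<alpha> i $ j * X ((p \<circ> ?\<tau>) i) $ j)
        = (\<Prod>i<N. \<Sum>j\<in>UNIV. \<alpha> (?\<tau> i) $ j * X ((p \<circ> ?\<tau>) i) $ j)"
      using eq by (intro prod.cong) (auto simp: Transposition.transpose_def)
    also have "\<dots> = (\<Prod>i<N. \<Sum>j\<in>UNIV. \<alpha> i $ j * X (p i) $ j)"
      using prod.permute[OF \<tau>, of "\<lambda>i. \<Sum>j\<in>UNIV. \<alpha> i $ j * X (p i) $ j"] by simp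
    finally show ?thesis
      using sgn by (simp add: f_def)
  qed
  have "wedge N \<alpha> X = sum f ?S"
    by (simp add: wedge_def f_def)
  also have "\<dots> = (\<Sum>p\<in>?S. f (p \<circ> ?\<tau>))"
    using \<tau> by (rule sum_permutations_compose_right)
  also have "\<dots> = - sum f ?S"
    using f by (simp add: sum_negf)
  finally have "wedge N \<alpha> X = - wedge N \<alpha> X"
    using \<open>wedge N \<alpha> X = sum f ?S\<close> by simp
  then show ?thesis
    by simp
qed

lemma dim_eq_if_wedge_nonzero:
  fixes \<alpha> :: "nat \<Rightarrow> 'a::field_char_0 ^ 'n"
  assumes nz: "wedge N \<alpha> X \<noteq> 0"
  shows "vec.dim (\<alpha> ` {..<N}) = N"
proof -
  have notin: "\<alpha> k \<notin> vec.span (\<alpha> ` ({..<N} - {k}))" if k: "k < N" for k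
  proof
    \<comment> \<open>The covectors that kill the wedge in slot \<open>k\<close> form a subspace
      containing all the other \<open>\<alpha> l\<close>. If \<open>\<alpha> k\<close> were in their
      span, it would be in \<open>?Z\<close> too, contradicting \<open>nz\<close>.\<close>
    let ?Z = "{\<beta>. wedge N (\<alpha>(k := \<beta>)) X = 0}"
    assume "\<alpha> k \<in> vec.span (\<alpha> ` ({..<N} - {k}))"
    moreover have "\<alpha> l \<in> ?Z" if "l \<in> {..<N} - {k}" for l
      using k that wedge_eq_0_if_repeated[of k N l "\<alpha>(k := \<alpha> l)"] by auto
    then have "\<alpha> ` ({..<N} - {k}) \<subseteq> ?Z"
      by blast
    moreover have "vec.subspace ?Z"
      unfolding vec.subspace_def
    proof (intro conjI ballI allI)
      show "0 \<in> ?Z"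
        by (simp add: wedge_fun_upd[OF k])
      show "x + y \<in> ?Z" if "x \<in> ?Z" "y \<in> ?Z" for x y
        using that by (simp add: wedge_fun_upd[OF k] distrib_left distrib_right sum.distrib)
      show "c *s x \<in> ?Z" if "x \<in> ?Z" for c x
      proof -
        have "wedge N (\<alpha>(k := c *s x)) X = c * wedge N (\<alpha>(k := x)) X"
        proof -
          have "(\<Sum>j\<in>UNIV. (c *s x) $ j * X q $ j) = c * (\<Sum>j\<in>UNIV. x $ j * X q $ j)" for q
            by (simp add: sum_distrib_left mult.assoc)
          then show ?thesis
            unfolding wedge_fun_upd[OF k] sum_distrib_left[of c _ "{p. p permutes {..<N}}"]
            by (intro sum.cong) (simp_all only: mult.left_commute)
        qed
        then show ?thesis
          using that by simp
      qed
    qed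
    ultimately have "wedge N (\<alpha>(k := \<alpha> k)) X = 0"
      using vec.span_minimal by blast
    then show False
      using nz by simp
  qed
  have "inj_on \<alpha> {..<N}"
  proof (rule inj_onI, rule ccontr)
    fix k l assume "k \<in> {..<N}" "l \<in> {..<N}" "\<alpha> k = \<alpha> l" "k \<noteq> l"
    then show False
      using wedge_eq_0_if_repeated[of k N l \<alpha> X] nz by simp
  qed
  moreover have "vec.independent (\<alpha> ` {..<N})"
    unfolding vec.dependent_def
  proof clarsimp
    fix k assume k: "k < N" "\<alpha> k \<in> vec.span (\<alpha> ` {..<N} - {\<alpha> k})"
    have "\<alpha> ` {..<N} - {\<alpha> k} \<subseteq> \<alpha> ` ({..<N} - {k})"
      by auto
    then show False
      using k notin vec.span_mono by blast
  qed
  ultimately show ?thesis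
    by (simp add: vec.dim_eq_card_independent card_image)
qed

text \<open>This is the pointwise core, with \<open>\<alpha> i\<close> the differentials of the
  integrals at a point and \<open>P\<close> a member of the pencil there. Isotropy passes from the
  generators to their span, of dimension \<open>N\<close>. The field is arbitrary, so complexified
  real data are covered.\<close>

lemma in_range_if_annihilated_by_isotropic:
  fixes P :: "'a::field_char_0 ^ 'n ^ 'n"
  assumes skew: "\<And>i j. P $ i $ j = - P $ j $ i"
    and nz: "wedge N \<alpha> X \<noteq> 0"
    and iso: "\<And>i j. i < N \<Longrightarrow> j < N \<Longrightarrow> (\<Sum>k\<in>UNIV. \<Sum>l\<in>UNIV. P $ k $ l * \<alpha> i $ k * \<alpha> j $ l) = 0"
    and v: "\<And>i. i < N \<Longrightarrow> (\<Sum>k\<in>UNIV. v $ k * \<alpha> i $ k) = 0"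
    and dim: "2 * CARD('n) \<le> 2 * N + rank P"
  shows "v \<in> range ((*v) P)"
proof -
  define L where "L = vec.span (\<alpha> ` {..<N})"
  have ann: "annihilator L = annihilator (\<alpha> ` {..<N})"
    by (simp add: L_def annihilator_span)
  have "P *v \<alpha> j \<in> annihilator L" if "j < N" for j
    using iso[OF _ that] unfolding ann
    by (auto simp: annihilator_def matrix_vector_mult_def sum_distrib_left mult_ac)
  moreover have "vec.subspace {y. P *v y \<in> annihilator L}"
    using subspace_annihilator[of L]
    by (auto simp: vec.subspace_def matrix_vector_right_distrib vector_scalar_commute)
  ultimately have "L \<subseteq> {y. P *v y \<in> annihilator L}"
    unfolding L_def by (intro vec.span_minimal) auto
  then have iso_L: "P *v y \<in> annihilator {x}" if "x \<in> L" "y \<in> L" for x y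
    using that annihilator_antimono[of "{x}" L] by blast
  have "2 * CARD('n) \<le> 2 * vec.dim L + rank P"
    using dim dim_eq_if_wedge_nonzero[OF nz] by (simp add: L_def)
  moreover have "vec.subspace L"
    by (simp add: L_def)
  ultimately have "annihilator L \<subseteq> range ((*v) P)"
    using annihilator_isotropic_subset_range[OF skew _ iso_L] by blast
  moreover have "v \<in> annihilator L"
    using v unfolding ann by (auto simp: annihilator_def mult.commute)
  ultimately show ?thesis
    by blast
qed

subsection \<open>Generic properties\<close>

lemma generically_conj:
  assumes "generically X P" "generically X Q"
  shows "generically X (\<lambda>x. P x \<and> Q x)"
proof -
  obtain G H where G: "openin X G" "X closure_of G = topspace X" "\<forall>x\<in>G. P x"
    and H: "openin X H" "X closure_of H = topspace X" "\<forall>x\<in>H. Q x"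
    using assms unfolding generically_def by blast
  have "X closure_of (G \<inter> H) = topspace X"
    unfolding dense_intersects_open
  proof (intro allI impI)
    fix T assume T: "openin X T \<and> T \<noteq> {}"
    then have "openin X (G \<inter> T)" "G \<inter> T \<noteq> {}"
      using G by (auto simp: dense_intersects_open)
    then have "H \<inter> (G \<inter> T) \<noteq> {}"
      using H(2) unfolding dense_intersects_open by blast
    then show "G \<inter> H \<inter> T \<noteq> {}"
      by blast
  qed
  then show ?thesis
    using G H unfolding generically_def by (meson IntD1 IntD2 openin_Int)
qed

lemma generically_mono:
  "generically X P \<Longrightarrow> (\<And>x. x \<in> topspace X \<Longrightarrow> P x \<Longrightarrow> Q x) \<Longrightarrow> generically X Q"
  unfolding generically_def by (meson openin_subset subsetD)

text \<open>The union of all open sets on which \<open>Q\<close> holds is dense: an open set meets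
  the dense set where \<open>P\<close> holds, and near such a point \<open>Q\<close> holds on a
  dense open subset of a neighborhood.\<close>

lemma generically_local:
  assumes P: "generically X P"
    and local: "\<And>x. P x \<Longrightarrow> \<exists>U. openin X U \<and> x \<in> U \<and> generically (subtopology X U) Q"
  shows "generically X Q"
proof -
  obtain G where G: "openin X G" "X closure_of G = topspace X" "\<forall>x\<in>G. P x"
    using P unfolding generically_def by blast
  let ?H = "\<Union>{H. openin X H \<and> (\<forall>x\<in>H. Q x)}"
  have "X closure_of ?H = topspace X"
    unfolding dense_intersects_open
  proof (intro allI impI)
    fix T assume T: "openin X T \<and> T \<noteq> {}"
    then obtain x where x: "x \<in> G" "x \<in> T"
      using G(2) unfolding dense_intersects_open by blast
    then obtain U where U: "openin X U" "x \<in> U" "generically (subtopology X U) Q"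
      using G(3) local by blast
    then obtain H where H: "openin (subtopology X U) H" "\<forall>x\<in>H. Q x"
      "subtopology X U closure_of H = topspace (subtopology X U)"
      unfolding generically_def by blast
    have "openin (subtopology X U) (T \<inter> U)" "T \<inter> U \<noteq> {}"
      using T U x by (auto simp: openin_open_subtopology)
    then have "H \<inter> (T \<inter> U) \<noteq> {}"
      using H(3) unfolding dense_intersects_open by blast
    moreover have "openin X H"
      using H(1) U(1) by (rule openin_trans_full)
    ultimately show "?H \<inter> T \<noteq> {}"
      using H(2) by blast
  qed
  moreover have "openin X ?H"
    by blast
  ultimately show ?thesis
    unfolding generically_def by blast
qed

subsection \<open>Rank along the pencil\<close>

text \<open>The set is a union of the nonvanishing loci of continuous determinants.\<close>

lemma openin_rank_ge:
  fixes F :: "'x \<Rightarrow> 'k::real_normed_field ^ 'n ^ 'n"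
  assumes F: "\<And>i j. continuous_map X euclidean (\<lambda>x. F x $ i $ j)"
  shows "openin X {x \<in> topspace X. r \<le> rank (F x)}"
proof -
  have "openin X {x \<in> topspace X. det (replace_rows I E (F x)) \<in> - {0}}" for I E
  proof (rule openin_continuous_map_preimage)
    have "continuous_map X euclidean (\<lambda>x. replace_rows I E (F x) $ i $ j)" for i j
      using F[of i j] by (cases "i \<in> I") (simp_all add: replace_rows_def)
    then show "continuous_map X euclidean (\<lambda>x. det (replace_rows I E (F x)))"
      unfolding det_def continuous_map_atin limitin_canonical_iff
      by (intro ballI tendsto_sum tendsto_mult tendsto_const tendsto_prod) auto
  qed auto
  then have "openin X (\<Union>(I, E)\<in>{(I, E). r \<le> card I}. {x \<in> topspace X. det (replace_rows I E (F x)) \<in> - {0}})"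
    by (intro openin_Union) auto
  also have "\<dots> = {x \<in> topspace X. r \<le> rank (F x)}"
    unfolding rank_ge_iff_det_replace_rows by auto
  finally show ?thesis .
qed

section \<open>Density of rank bounds along a holomorphic parameter\<close>

lemma nonvanishing_dense:
  assumes f: "f holomorphic_on S" "open S" "connected S"
    and z: "z \<in> S" "f z \<noteq> 0"
    and w: "open U" "w \<in> U" "w \<in> S"
  shows "\<exists>w'\<in>U \<inter> S. f w' \<noteq> 0"
proof (rule ccontr)
  assume "\<not> ?thesis"
  then have "\<And>w'. w' \<in> U \<inter> S \<Longrightarrow> f w' = 0"
    by blast
  \<comment> \<open>A nonempty open set accumulates at each of its points, so vanishing on
    \<open>U \<inter> S\<close> would spread over the connected set \<open>S\<close> up to
    \<open>z\<close>.\<close>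
  moreover have "w islimpt (U \<inter> S)"
    using f w by (intro interior_limit_point) (auto simp: interior_open open_Int)
  ultimately have "f z = 0"
    using f z w by (intro analytic_continuation[of f S "U \<inter> S" w z]) auto
  with z show False
    by simp
qed

lemma holomorphic_on_det:
  fixes F :: "complex \<Rightarrow> complex ^ 'n ^ 'n"
  assumes "\<And>i j. (\<lambda>z. F z $ i $ j) holomorphic_on S"
  shows "(\<lambda>z. det (F z)) holomorphic_on S"
  unfolding det_def by (intro holomorphic_intros assms)

lemma holomorphic_on_det_replace_rows:
  fixes F :: "complex \<Rightarrow> complex ^ 'n ^ 'n"
  assumes "\<And>i j. (\<lambda>z. F z $ i $ j) holomorphic_on S"
  shows "(\<lambda>z. det (replace_rows I E (F z))) holomorphic_on S"
proof (rule holomorphic_on_det)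
  show "(\<lambda>z. replace_rows I E (F z) $ i $ j) holomorphic_on S" for i j
    using assms[of i j] by (cases "i \<in> I") (simp_all add: replace_rows_def)
qed

text \<open>The rows \<open>I\<close> and the filling \<open>E\<close> that witness the rank at
  \<open>z\<close> are kept fixed; the resulting determinant is a holomorphic function of the
  parameter that is nonzero at \<open>z\<close>.\<close>

lemma rank_ge_dense:
  fixes F :: "complex \<Rightarrow> complex ^ 'n ^ 'n"
  assumes F: "\<And>i j. (\<lambda>z. F z $ i $ j) holomorphic_on S" and S: "open S" "connected S"
    and z: "z \<in> S" "r \<le> rank (F z)"
    and w: "open U" "w \<in> U" "w \<in> S"
  shows "\<exists>w'\<in>U \<inter> S. r \<le> rank (F w')"
proof -
  obtain I E where "r \<le> card I" "det (replace_rows I E (F z)) \<noteq> 0"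
    using z(2) rank_ge_iff_det_replace_rows by blast
  then show ?thesis
    using nonvanishing_dense[OF holomorphic_on_det_replace_rows[OF F] S z(1) _ w]
      rank_ge_iff_det_replace_rows by meson
qed

text \<open>Scalars are written as matrices \<open>mat s\<close>, so that scaling becomes a matrix
  product and the rank bounds for products apply to it.\<close>

lemma mat_mult_nth:
  fixes Q :: "'a::comm_semiring_1 ^ 'n ^ 'n"
  shows "(mat s ** Q) $ i $ j = s * Q $ i $ j" "(Q ** mat s) $ i $ j = Q $ i $ j * s"
  by (simp_all add: mat_def matrix_matrix_mult_def if_distrib[of "\<lambda>a. a * _"]
      if_distrib[of "\<lambda>a. _ * a"] cong: if_cong)

text \<open>The bound may be given at the point at infinity only. It is first moved to a finite
  parameter and then spread over the plane by the identity theorem.\<close>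

lemma rank_pencil_dense:
  fixes A B :: "'c \<Rightarrow> 'm \<Rightarrow> complex ^ 'n ^ 'n"
  assumes l: "r \<le> rank (pencil A B l c x)" and U: "open U" "U \<noteq> {}"
  shows "\<exists>z\<in>U. r \<le> rank (pencil A B (Some z) c x)"
proof -
  have "\<exists>t. r \<le> rank (pencil A B (Some t) c x)"
  proof (cases l)
    case None
    \<comment> \<open>This is the affine coordinate \<open>s = 1 / t\<close> around infinity, where
      the pencil reads \<open>s A + B\<close> up to a scalar and \<open>s = 0\<close> gives
      \<open>B\<close>.\<close>
    let ?F = "\<lambda>s. lin_comb s A 1 B c x"
    have "?F 0 = pencil A B None c x"
      by (simp add: pencil_def lin_comb_def vec_eq_iff)
    then have "r \<le> rank (?F 0)"
      using l None by simp
    moreover have "(\<lambda>s. ?F s $ i $ j) holomorphic_on UNIV" for i j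
      unfolding lin_comb_def by (auto intro!: holomorphic_intros)
    ultimately obtain s where s: "s \<noteq> 0" "r \<le> rank (?F s)"
      \<comment> \<open>The target open set is the punctured plane with \<open>1\<close> as a point
        of it, which forces \<open>s \<noteq> 0\<close>.\<close>
      using rank_ge_dense[of ?F UNIV 0 r "- {0}" 1] by auto
    have "?F s = mat s ** pencil A B (Some (1 / s)) c x"
      using s(1) by (simp add: pencil_def lin_comb_def mat_mult_nth vec_eq_iff distrib_left)
    then have "r \<le> rank (pencil A B (Some (1 / s)) c x)"
      using s(2) rank_mult_le_right le_trans by metis
    then show ?thesis ..
  next
    case (Some t)
    then show ?thesis
      using l by blast
  qed
  then obtain t where "r \<le> rank (pencil A B (Some t) c x)" ..
  moreover have "(\<lambda>z. pencil A B (Some z) c x $ i $ j) holomorphic_on UNIV" for i j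
    unfolding pencil_def lin_comb_def by (auto intro!: holomorphic_intros)
  moreover obtain w where "w \<in> U"
    using U(2) by blast
  ultimately show ?thesis
    using U(1) rank_ge_dense[of "\<lambda>z. pencil A B (Some z) c x" UNIV t r U w] by auto
qed

text \<open>A neighborhood of infinity is the complement of a compact set, and the plane is not
  compact. Density on the sphere can thus be tested with finite parameters.\<close>

lemma riemann_sphere_open_meets_plane:
  assumes V: "openin riemann_sphere V" "V \<noteq> {}"
  shows "\<exists>U. open U \<and> U \<noteq> {} \<and> Some ` U \<subseteq> V"
  using V(1) unfolding openin_Alexandroff_compactification
proof (elim disjE exE conjE)
  fix U assume "openin euclidean U" "V = Some ` U"
  then show ?thesis
    using V(2) by auto
next
  fix C :: "complex set" assume C: "compactin euclidean C" "V = insert None (Some ` (topspace euclidean - C))"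
  then have "C \<noteq> UNIV"
    using not_compact_UNIV by auto
  then show ?thesis
    using C by (intro exI[of _ "- C"]) (auto intro: compact_imp_closed)
qed

text \<open>Common to the real and the complex case: matrices are complex while charts may be real,
  so the change of charts enters through some complex \<open>J\<close>. It remains to know that for
  generic \<open>x\<close> the rank bound holds for some parameter, and that it implies the image
  condition.\<close>

lemma generically_in_image:
  fixes \<Phi> :: "('m, 'k::real_normed_field, 'n::finite) chart set"
    and A B :: "('m, 'k, 'n) chart \<Rightarrow> 'm \<Rightarrow> complex ^ 'n ^ 'n"
  assumes charts: "\<And>c. c \<in> \<Phi> \<Longrightarrow> openin M (fst c)" "(\<Union>c\<in>\<Phi>. fst c) = topspace M"
    and cont: "\<And>c i j. c \<in> \<Phi> \<Longrightarrow> continuous_map (subtopology M (fst c)) euclidean (\<lambda>x. A c x $ i $ j)"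
      "\<And>c i j. c \<in> \<Phi> \<Longrightarrow> continuous_map (subtopology M (fst c)) euclidean (\<lambda>x. B c x $ i $ j)"
    and trans: "\<And>c d x. c \<in> \<Phi> \<Longrightarrow> d \<in> \<Phi> \<Longrightarrow> x \<in> fst c \<inter> fst d \<Longrightarrow>
      \<exists>J. A d x = J ** A c x ** transpose J \<and> B d x = J ** B c x ** transpose J"
    and gen: "generically M (\<lambda>x. \<forall>c\<in>\<Phi>. x \<in> fst c \<longrightarrow> (\<exists>l. r \<le> rank (pencil A B l c x)) \<and>
      (\<forall>l. r \<le> rank (pencil A B l c x) \<longrightarrow> v c x \<in> range ((*v) (pencil A B l c x))))"
  shows "generically (prod_topology riemann_sphere M) (\<lambda>(l, x). in_image \<Phi> v (pencil A B l) x)"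
proof -
  let ?X = "prod_topology riemann_sphere M"
  obtain G where G: "openin M G" "M closure_of G = topspace M"
    and G': "\<And>x c. x \<in> G \<Longrightarrow> c \<in> \<Phi> \<Longrightarrow> x \<in> fst c \<Longrightarrow> \<exists>l. r \<le> rank (pencil A B l c x)"
      "\<And>x c l. x \<in> G \<Longrightarrow> c \<in> \<Phi> \<Longrightarrow> x \<in> fst c \<Longrightarrow> r \<le> rank (pencil A B l c x)
        \<Longrightarrow> v c x \<in> range ((*v) (pencil A B l c x))"
    using gen unfolding generically_def by blast
  \<comment> \<open>Infinity is left out, and the rank bound is asked in one chart only, which makes
    openness a matter of that chart. The other charts follow from the transformation law.\<close>
  define H where
    "H = {(Some l, x) | l x. x \<in> G \<and> (\<exists>c\<in>\<Phi>. x \<in> fst c \<and> r \<le> rank (pencil A B (Some l) c x))}"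
  have "openin ?X H"
    unfolding openin_prod_topology_alt
  proof (intro allI impI)
    fix lo x assume "(lo, x) \<in> H"
    then obtain l c where l: "lo = Some l" and x: "x \<in> G" "x \<in> fst c" and c: "c \<in> \<Phi>"
      and r: "r \<le> rank (pencil A B (Some l) c x)"
      by (auto simp: H_def)
    let ?Y = "prod_topology euclidean (subtopology M (fst c)) :: (complex \<times> 'm) topology"
    define R where "R = {z \<in> topspace ?Y. r \<le> rank (pencil A B (Some (fst z)) c (snd z))}"
    have A: "continuous_map ?Y euclidean (\<lambda>z. A c (snd z) $ i $ j)" for i j
      using continuous_map_compose[OF continuous_map_snd cont(1)[OF c]] by (simp add: o_def)
    have B: "continuous_map ?Y euclidean (\<lambda>z. B c (snd z) $ i $ j)" for i j
      using continuous_map_compose[OF continuous_map_snd cont(2)[OF c]] by (simp add: o_def)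
    have fst: "continuous_map ?Y euclidean fst"
      by (rule continuous_map_fst)
    have "continuous_map ?Y euclidean (\<lambda>z. pencil A B (Some (fst z)) c (snd z) $ i $ j)" for i j
    proof -
      have "pencil A B (Some (fst z)) c (snd z) $ i $ j = A c (snd z) $ i $ j + fst z * B c (snd z) $ i $ j"
        for z :: "complex \<times> 'm"
        by (simp add: pencil_def lin_comb_def)
      then show ?thesis
        using A[of i j] B[of i j] fst unfolding continuous_map_atin limitin_canonical_iff
        by (auto intro!: tendsto_add tendsto_mult)
    qed
    then have R: "openin ?Y R"
      unfolding R_def by (rule openin_rank_ge)
    have lx: "(l, x) \<in> R"
      using r x G(1) openin_subset by (fastforce simp: R_def)
    obtain U V where U: "openin euclidean U" "l \<in> U" and V: "openin (subtopology M (fst c)) V" "x \<in> V"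
      and UV: "U \<times> V \<subseteq> R"
      using R[unfolded openin_prod_topology_alt, rule_format, OF lx] by (elim exE conjE)
    have V': "openin M V" "V \<subseteq> fst c"
      using V(1) charts(1)[OF c] by (simp_all add: openin_open_subtopology)
    have "Some ` U \<times> (V \<inter> G) \<subseteq> H"
      using UV V'(2) c by (fastforce simp: H_def R_def)
    moreover have "openin riemann_sphere (Some ` U)"
      using U(1) by simp
    moreover have "openin M (V \<inter> G)"
      using V'(1) G(1) by blast
    ultimately show "\<exists>U V. openin riemann_sphere U \<and> openin M V \<and> lo \<in> U \<and> x \<in> V \<and> U \<times> V \<subseteq> H"
      using U(2) V(2) x(1) l by blast
  qed
  moreover have "?X closure_of H = topspace ?X"
    unfolding dense_intersects_open
  proof (intro allI impI)
    fix T assume T: "openin ?X T \<and> T \<noteq> {}"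
    then obtain U V where U: "openin riemann_sphere U" "U \<noteq> {}" and V: "openin M V" "V \<noteq> {}"
      and UV: "U \<times> V \<subseteq> T"
      unfolding openin_prod_topology_alt by (metis ex_in_conv surj_pair)
    obtain U' where U': "open U'" "U' \<noteq> {}" "Some ` U' \<subseteq> U"
      using riemann_sphere_open_meets_plane[OF U] by blast
    obtain x where x: "x \<in> G" "x \<in> V"
      using V G(2) unfolding dense_intersects_open by blast
    then obtain c where c: "c \<in> \<Phi>" "x \<in> fst c"
      using charts(2) V(1) openin_subset by blast
    then obtain l where "l \<in> U'" "r \<le> rank (pencil A B (Some l) c x)"
      using G'(1)[OF x(1) c] rank_pencil_dense U'(1,2) by metis
    then have "(Some l, x) \<in> H" "(Some l, x) \<in> T"
      using x c UV U'(3) by (auto simp: H_def)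
    then show "H \<inter> T \<noteq> {}"
      by blast
  qed
  moreover have "in_image \<Phi> v (pencil A B lo) x" if H: "(lo, x) \<in> H" for lo x
    unfolding in_image_def
  proof (intro ballI impI)
    fix d assume d: "d \<in> \<Phi>" "x \<in> fst d"
    obtain l c where l: "lo = Some l" and x: "x \<in> G" "x \<in> fst c" and c: "c \<in> \<Phi>"
      and r: "r \<le> rank (pencil A B (Some l) c x)"
      using H by (auto simp: H_def)
    obtain J where J: "A c x = J ** A d x ** transpose J" "B c x = J ** B d x ** transpose J"
      using trans[of d c x] c d x by blast
    have lin: "pencil A B (Some l) e y = A e y + mat l ** B e y" for e y
      by (simp add: pencil_def lin_comb_def mat_mult_nth vec_eq_iff)
    have comm: "mat l ** Q = Q ** mat l" for Q :: "complex ^ 'n ^ 'n"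
      by (simp add: mat_mult_nth vec_eq_iff mult.commute)
    have rdistrib: "(P + Q) ** R = P ** R + Q ** R" for P Q R :: "complex ^ 'n ^ 'n"
      by (simp add: matrix_matrix_mult_def vec_eq_iff sum.distrib distrib_right)
    \<comment> \<open>Scalar matrices commute with \<open>J\<close>, so the whole pencil transforms
      by the same congruence and the rank bound passes from \<open>c\<close> to
      \<open>d\<close>.\<close>
    have "pencil A B (Some l) c x = J ** pencil A B (Some l) d x ** transpose J"
      unfolding lin J by (simp add: matrix_add_ldistrib rdistrib matrix_mul_assoc comm[of J])
    then have "r \<le> rank (pencil A B lo d x)"
      using r rank_congruence_le le_trans l by metis
    then show "v d x \<in> range ((*v) (pencil A B lo d x))"
      using G'(2) x(1) d by blast
  qed
  ultimately show ?thesis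
    unfolding generically_def by blast
qed

subsection \<open>Rank on connected complex manifolds\<close>

lemma is_chartD:
  assumes "is_chart M c"
  shows is_chart_openin: "openin M (fst c)"
    and is_chart_open_image: "open (snd c ` fst c)"
    and is_chart_homeomorphic: "homeomorphic_map (subtopology M (fst c)) (top_of_set (snd c ` fst c)) (snd c)"
    and is_chart_inv: "\<And>x. x \<in> fst c \<Longrightarrow> chart_inv c (snd c x) = x"
    and is_chart_topspace: "topspace (subtopology M (fst c)) = fst c"
proof -
  show o: "openin M (fst c)" and "open (snd c ` fst c)"
    and h: "homeomorphic_map (subtopology M (fst c)) (top_of_set (snd c ` fst c)) (snd c)"
    using assms by (auto simp: is_chart_def)
  show t: "topspace (subtopology M (fst c)) = fst c"
    using openin_subset[OF o] by (simp add: Int_absorb1)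
  have "inj_on (snd c) (fst c)"
    using homeomorphic_imp_injective_map[OF h] t by simp
  then show "chart_inv c (snd c x) = x" if "x \<in> fst c" for x
    using that by (simp add: chart_inv_def)
qed

lemma continuous_map_if_smooth_in_chart:
  assumes c: "is_chart M c" and f: "smooth_on (chart_image c (fst c)) (\<lambda>y. f (chart_inv c y))"
  shows "continuous_map (subtopology M (fst c)) euclidean f"
proof -
  have "Ck_on 0 (snd c ` fst c) (\<lambda>y. f (chart_inv c y))"
    using f by (simp add: smooth_on_def chart_image_def del: Ck_on.simps)
  then have "continuous_map (top_of_set (snd c ` fst c)) euclidean (\<lambda>y. f (chart_inv c y))"
    by simp
  from continuous_map_compose[OF homeomorphic_imp_continuous_map[OF is_chart_homeomorphic[OF c]] this]
  show ?thesis
    by (rule continuous_map_eq) (use is_chart_inv[OF c] is_chart_topspace[OF c] in auto)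
qed

text \<open>One order of smoothness already provides a complex-linear differential, and the chain
  rule along the line gives a complex derivative in one variable, where the identity theorem is
  available.\<close>

lemma smooth_on_line_holomorphic:
  fixes g :: "complex ^ 'n \<Rightarrow> complex"
  assumes g: "smooth_on S g" and a: "\<And>t. t \<in> T \<Longrightarrow> a + t *s w \<in> S"
  shows "(\<lambda>t. g (a + t *s w)) holomorphic_on T"
proof (rule holomorphic_onI)
  fix t assume t: "t \<in> T"
  have "Ck_on (Suc 0) S g"
    using g by (simp add: smooth_on_def del: Ck_on.simps)
  then obtain g' where g': "(g has_derivative (\<lambda>h. \<Sum>i\<in>UNIV. g' i (a + t *s w) * h $ i)) (at (a + t *s w))"
    using a[OF t] by auto
  have "linear (\<lambda>s. s *s w)"
    by (simp add: linear_iff vector_sadd_rdistrib vec_eq_iff)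
  then have "((\<lambda>t. a + t *s w) has_derivative (\<lambda>s. s *s w)) (at t)"
    by (auto intro!: derivative_eq_intros bounded_linear_imp_has_derivative
        simp: linear_conv_bounded_linear)
  from diff_chain_at[OF this g']
  have "((\<lambda>t. g (a + t *s w)) has_derivative (\<lambda>s. (\<Sum>i\<in>UNIV. g' i (a + t *s w) * w $ i) * s)) (at t)"
    by (simp add: o_def sum_distrib_left sum_distrib_right mult_ac)
  then have "((\<lambda>t. g (a + t *s w)) has_field_derivative (\<Sum>i\<in>UNIV. g' i (a + t *s w) * w $ i)) (at t)"
    by (simp add: has_field_derivative_def)
  then show "(\<lambda>t. g (a + t *s w)) field_differentiable at t within T"
    using field_differentiable_def field_differentiable_at_within by blast
qed

lemma bivector_fieldD:
  assumes "bivector_field \<Phi> P"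
  shows bivector_field_smooth:
      "\<And>c i j. c \<in> \<Phi> \<Longrightarrow> smooth_on (chart_image c (fst c)) (\<lambda>y. P c (chart_inv c y) $ i $ j)"
    and bivector_field_skew: "\<And>c x i j. c \<in> \<Phi> \<Longrightarrow> x \<in> fst c \<Longrightarrow> P c x $ i $ j = - P c x $ j $ i"
    and bivector_field_transform: "\<And>c d x. c \<in> \<Phi> \<Longrightarrow> d \<in> \<Phi> \<Longrightarrow> x \<in> fst c \<inter> fst d \<Longrightarrow>
      P d x = jacobian c d x ** P c x ** transpose (jacobian c d x)"
proof -
  note P = assms[unfolded bivector_field_def]
  show "smooth_on (chart_image c (fst c)) (\<lambda>y. P c (chart_inv c y) $ i $ j)" if "c \<in> \<Phi>" for c i j
    using that by (rule P[THEN conjunct1, rule_format])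
  show "P c x $ i $ j = - P c x $ j $ i" if "c \<in> \<Phi>" "x \<in> fst c" for c x i j
    using that by (rule P[THEN conjunct2, THEN conjunct1, rule_format])
  show "P d x = jacobian c d x ** P c x ** transpose (jacobian c d x)"
    if "c \<in> \<Phi>" "d \<in> \<Phi>" "x \<in> fst c \<inter> fst d" for c d x
    using that by (rule P[THEN conjunct2, THEN conjunct2, rule_format])
qed

lemma rank_bivector_chart_invariant:
  assumes P: "bivector_field \<Phi> P" and "c \<in> \<Phi>" "d \<in> \<Phi>" "x \<in> fst c" "x \<in> fst d"
  shows "rank (P c x) = rank (P d x)"
proof -
  have "rank (P e x) \<le> rank (P e' x)" if "e \<in> \<Phi>" "e' \<in> \<Phi>" "x \<in> fst e" "x \<in> fst e'" for e e'
  proof -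
    have "P e x = jacobian e' e x ** P e' x ** transpose (jacobian e' e x)"
      by (rule bivector_field_transform[OF P]) (use that in auto)
    then show ?thesis
      by (simp add: rank_congruence_le)
  qed
  then show ?thesis
    using assms by (intro antisym)
qed

text \<open>The identity theorem is applied along complex lines in a coordinate ball.\<close>

lemma rank_ge_generically:
  fixes \<Phi> :: "('m, complex, 'n::finite) chart set"
  assumes M: "manifold M \<Phi>" "connected_space M" and P: "bivector_field \<Phi> P"
    and r: "c0 \<in> \<Phi>" "x0 \<in> fst c0" "r \<le> rank (P c0 x0)"
  shows "generically M (\<lambda>x. \<forall>c\<in>\<Phi>. x \<in> fst c \<longrightarrow> r \<le> rank (P c x))"
proof -
  have chart: "is_chart M c" if "c \<in> \<Phi>" for c
    using M(1) that by (simp add: manifold_def)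
  have cover: "(\<Union>c\<in>\<Phi>. fst c) = topspace M"
    using M(1) by (simp add: manifold_def)
  have smooth: "smooth_on (snd c ` fst c) (\<lambda>y. P c (chart_inv c y) $ i $ j)" if "c \<in> \<Phi>" for c i j
    using bivector_field_smooth[OF P that] by (simp add: chart_image_def)
  define G where "G = {x \<in> topspace M. \<forall>c\<in>\<Phi>. x \<in> fst c \<longrightarrow> r \<le> rank (P c x)}"
  have G_iff: "x \<in> G \<longleftrightarrow> r \<le> rank (P c x)" if "c \<in> \<Phi>" "x \<in> fst c" for x c
  proof -
    have "rank (P d x) = rank (P c x)" if "d \<in> \<Phi>" "x \<in> fst d" for d
      by (rule rank_bivector_chart_invariant[OF P]) fact+
    moreover have "x \<in> topspace M"
      using cover that by blast
    ultimately show ?thesis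
      unfolding G_def mem_Collect_eq using that by metis
  qed
  have "openin M G"
  proof (subst openin_subopen, intro ballI)
    fix x assume x: "x \<in> G"
    then obtain c where c: "c \<in> \<Phi>" "x \<in> fst c"
      using cover unfolding G_def by blast
    let ?T = "{y \<in> topspace (subtopology M (fst c)). r \<le> rank (P c y)}"
    have "openin (subtopology M (fst c)) ?T"
    proof (rule openin_rank_ge)
      show "continuous_map (subtopology M (fst c)) euclidean (\<lambda>x. P c x $ i $ j)" for i j
        using chart[OF c(1)] smooth[OF c(1)]
        by (intro continuous_map_if_smooth_in_chart) (auto simp: chart_image_def)
    qed
    then have "openin M ?T"
      using is_chart_openin[OF chart[OF c(1)]] by (rule openin_trans_full)
    moreover have "x \<in> ?T" "?T \<subseteq> G"
      using x c G_iff[OF c(1)] is_chart_topspace[OF chart[OF c(1)]] by auto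
    ultimately show "\<exists>T. openin M T \<and> x \<in> T \<and> T \<subseteq> G"
      by blast
  qed
  \<comment> \<open>An open closure is clopen; being nonempty, it is all of the connected space
    \<open>M\<close>.\<close>
  have "openin M (M closure_of G)"
  proof (subst openin_subopen, intro ballI)
    fix x assume x: "x \<in> M closure_of G"
    then obtain c where c: "c \<in> \<Phi>" "x \<in> fst c"
      using cover unfolding in_closure_of by blast
    note ch = chart[OF c(1)]
    obtain e where e: "e > 0" "ball (snd c x) e \<subseteq> snd c ` fst c"
      using is_chart_open_image[OF ch] c(2) by (meson imageI openE)
    let ?B = "ball (snd c x) e"
    define T where "T = {y \<in> topspace (subtopology M (fst c)). snd c y \<in> ?B}"
    have "openin (top_of_set (snd c ` fst c)) ?B"
      using e(2) by (auto simp: openin_open)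
    then have "openin (subtopology M (fst c)) T"
      unfolding T_def using homeomorphic_imp_continuous_map[OF is_chart_homeomorphic[OF ch]]
      by (intro openin_continuous_map_preimage)
    then have T: "openin M T"
      using is_chart_openin[OF ch] by (rule openin_trans_full)
    have T_iff: "y \<in> T \<longleftrightarrow> y \<in> fst c \<and> snd c y \<in> ?B" for y
      by (simp only: T_def is_chart_topspace[OF ch] mem_Collect_eq)
    have "x \<in> T"
      using c(2) e(1) by (simp add: T_iff)
    then obtain x1 where x1: "x1 \<in> G" "x1 \<in> T"
      using x T by (auto simp: in_closure_of)
    have "T \<subseteq> M closure_of G"
    proof
      fix x2 assume x2: "x2 \<in> T"
      have "\<exists>y. y \<in> G \<and> y \<in> V" if V: "x2 \<in> V" "openin M V" for V
      proof -
        \<comment> \<open>The complex line through the two points passes through \<open>x1\<close>,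
          where the bound holds, at parameter 0 and through \<open>x2\<close> at parameter 1. The
          set \<open>S\<close> of parameters staying in the ball is convex, hence connected.\<close>
        define a w where "a = snd c x1" and "w = snd c x2 - snd c x1"
        define S where "S = {t. a + t *s w \<in> ?B}"
        have lin: "linear (\<lambda>t. t *s w)"
          by (simp add: linear_iff vector_sadd_rdistrib vec_eq_iff)
        then have cont: "continuous_on UNIV (\<lambda>t. a + t *s w)"
          by (intro continuous_intros linear_continuous_on) (simp add: linear_conv_bounded_linear)
        have "open S"
          unfolding S_def using open_vimage[OF open_ball cont] by (simp add: vimage_def)
        have "convex ((\<lambda>t. t *s w) -` ((\<lambda>y. - a + y) ` ?B))"
          using lin by (intro convex_linear_vimage convex_translation) auto
        moreover have "(\<lambda>t. t *s w) -` ((\<lambda>y. - a + y) ` ?B) = S"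
          by (auto simp: S_def image_iff algebra_simps intro!: bexI)
        ultimately have "connected S"
          by (simp add: convex_connected)
        have "V \<inter> T \<subseteq> topspace (subtopology M (fst c))" "openin (subtopology M (fst c)) (V \<inter> T)"
          using V(2) T is_chart_openin[OF ch] is_chart_topspace[OF ch] T_iff
          by (auto simp: openin_open_subtopology)
        then have "openin (top_of_set (snd c ` fst c)) (snd c ` (V \<inter> T))"
          using homeomorphic_map_openness[OF is_chart_homeomorphic[OF ch]] by blast
        then have "open (snd c ` (V \<inter> T))"
          using is_chart_open_image[OF ch] openin_open_eq by blast
        \<comment> \<open>\<open>?U\<close> collects the parameters whose points lie in
          \<open>V \<inter> T\<close>. It is a neighborhood of 1, so the rank bound at some
          parameter of \<open>?U\<close> yields a point of \<open>G\<close> in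
          \<open>V\<close>.\<close>
        then have U: "open ((\<lambda>t. a + t *s w) -` (snd c ` (V \<inter> T)))" (is "open ?U")
          using cont by (rule open_vimage)
        have "(\<lambda>t. P c (chart_inv c (a + t *s w)) $ i $ j) holomorphic_on S" for i j
          using e(2) by (intro smooth_on_line_holomorphic[OF smooth[OF c(1)]]) (auto simp: S_def)
        moreover have "0 \<in> S" "1 \<in> S" "1 \<in> ?U"
          using x1 x2 V(1) T_iff by (auto simp: S_def a_def w_def)
        moreover have "r \<le> rank (P c (chart_inv c (a + 0 *s w)))"
          using x1 T_iff G_iff[OF c(1)] is_chart_inv[OF ch] by (simp add: a_def)
        ultimately obtain t where t: "t \<in> ?U" "r \<le> rank (P c (chart_inv c (a + t *s w)))"
          using rank_ge_dense[OF _ \<open>open S\<close> \<open>connected S\<close>, of "\<lambda>t. P c (chart_inv c (a + t *s w))" 0 r ?U 1] U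
          by blast
        then obtain y where y: "y \<in> V" "y \<in> T" "a + t *s w = snd c y"
          by auto
        then show ?thesis
          using t(2) T_iff G_iff[OF c(1)] is_chart_inv[OF ch] by auto
      qed
      then show "x2 \<in> M closure_of G"
        using x2 openin_subset[OF T] by (auto simp: in_closure_of)
    qed
    then show "\<exists>T. openin M T \<and> x \<in> T \<and> T \<subseteq> M closure_of G"
      using T \<open>x \<in> T\<close> by blast
  qed
  moreover have "x0 \<in> M closure_of G"
    using G_iff[OF r(1,2)] r(3) closure_of_subset[of G M] openin_subset[OF \<open>openin M G\<close>] by blast
  ultimately have "M closure_of G = topspace M"
    using M(2) unfolding connected_space_clopen_in by (metis closedin_closure_of empty_iff)
  with \<open>openin M G\<close> show ?thesis
    unfolding generically_def G_def by blast
qed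

subsection \<open>Complete sets of integrals\<close>

text \<open>Neighborhoods are discarded and only the data at the point are kept, with functions
  \<open>h\<close> that may vary with \<open>x\<close>. Independence is itself only generic inside
  each neighborhood, which calls for the local criterion of genericity.\<close>

lemma generically_isotropic_differentials:
  assumes "locally_bi_integrable M \<Phi> A B (v :: ('m, 'k::real_normed_field, 'n::finite) chart \<Rightarrow> _)"
    and N: "N = CARD('n) - pencil_rank \<Phi> A B div 2"
  shows "generically M (\<lambda>x. \<exists>h. \<forall>c\<in>\<Phi>. x \<in> fst c \<longrightarrow>
    wedge N (\<lambda>i. differential c (h i) x) \<noteq> (\<lambda>X. 0) \<and>
    (\<forall>i<N. (\<Sum>k\<in>UNIV. v c x $ k * partial c k (h i) x) = 0) \<and>
    (\<forall>i<N. \<forall>j<N. \<forall>l. bracket c (pencil A B l) (h i) (h j) x = 0))" (is "generically M ?Q")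
proof (rule generically_local)
  show "generically M (\<lambda>x. \<exists>U F. openin M U \<and> x \<in> U \<and>
       (\<forall>h\<in>F. integral_of \<Phi> v U h) \<and> in_bi_involution \<Phi> A B U F \<and> complete_on M \<Phi> A B U F)"
    using assms(1) unfolding locally_bi_integrable_def .
  fix x assume "\<exists>U F. openin M U \<and> x \<in> U \<and>
       (\<forall>h\<in>F. integral_of \<Phi> v U h) \<and> in_bi_involution \<Phi> A B U F \<and> complete_on M \<Phi> A B U F"
  then obtain U F where U: "openin M U" "x \<in> U"
    and int: "\<And>h. h \<in> F \<Longrightarrow> integral_of \<Phi> v U h" and inv: "in_bi_involution \<Phi> A B U F"
    and compl: "complete_on M \<Phi> A B U F"
    by blast
  obtain h where h: "\<And>i. i < N \<Longrightarrow> h i \<in> F" and ind: "functionally_independent M \<Phi> U N h"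
    using compl unfolding complete_on_def Let_def N by blast
  have "generically (subtopology M U) ?Q"
  proof (rule generically_mono[OF ind[unfolded functionally_independent_def]])
    fix y assume y: "y \<in> topspace (subtopology M U)"
      and w: "\<forall>c\<in>\<Phi>. y \<in> fst c \<longrightarrow> wedge N (\<lambda>i. differential c (h i) y) \<noteq> (\<lambda>X. 0)"
    have "y \<in> U"
      using y by simp
    then show "?Q y"
      using w int inv h by (intro exI[of _ h]) (simp add: integral_of_def in_bi_involution_def)
  qed
  then show "\<exists>U. openin M U \<and> x \<in> U \<and> generically (subtopology M U) ?Q"
    using U by blast
qed

text \<open>\<open>Max\<close> is meaningful for finite nonempty sets: ranks are bounded by the
  dimension, and the given point of a chart makes the set nonempty.\<close>

lemma pencil_rank_attained:
  fixes \<Phi> :: "('m, 'k::real_normed_field, 'n::finite) chart set"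
  assumes "c \<in> \<Phi>" "x \<in> fst c"
  obtains l c' x' where "c' \<in> \<Phi>" "x' \<in> fst c'" "rank (pencil A B l c' x') = pencil_rank \<Phi> A B"
proof -
  let ?R = "{rank (pencil A B l c x) | l c x. c \<in> \<Phi> \<and> x \<in> fst c}"
  have "?R \<subseteq> {..CARD('n)}"
    by (auto simp: row_rank_def_gen dim_subset_UNIV_cart_gen)
  then have "finite ?R"
    by (rule finite_subset) simp
  moreover have "?R \<noteq> {}"
    using assms by blast
  ultimately have "Max ?R \<in> ?R"
    by (rule Max_in)
  then obtain l c' x' where "Max ?R = rank (pencil A B l c' x')" "c' \<in> \<Phi>" "x' \<in> fst c'"
    by blast
  then show ?thesis
    using that by (simp add: pencil_rank_def)
qed

lemma pencil_skew:
  assumes "\<And>i j. A c x $ i $ j = - A c x $ j $ i" "\<And>i j. B c x $ i $ j = - B c x $ j $ i"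
  shows "pencil A B l c x $ i $ j = - pencil A B l c x $ j $ i"
  using assms(1)[of i j] assms(2)[of i j] by (cases l) (simp_all add: pencil_def lin_comb_def)

lemma compatible_poisson_pencil:
  assumes "compatible_poisson M \<Phi> A B"
  shows "bivector_field \<Phi> (pencil A B l)"
  using assms by (cases l) (auto simp: compatible_poisson_def poisson_def pencil_def)

lemma compatible_poissonD:
  assumes "compatible_poisson M \<Phi> A B"
  shows "bivector_field \<Phi> A" "bivector_field \<Phi> B"
  using assms by (auto simp: compatible_poisson_def poisson_def)

lemma generically_if_topspace_empty: "topspace X = {} \<Longrightarrow> generically X P"
  unfolding generically_def by (rule exI[of _ "{}"]) auto

section \<open>Complexified brackets and exterior products\<close>

lemma sum_bracket_cmat:
  "(\<Sum>k\<in>UNIV. \<Sum>m\<in>UNIV. cmat P c x $ k $ m * complex_of_real (differential c f x $ k)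
      * complex_of_real (differential c g x $ m)) = complex_of_real (bracket c P f g x)"
  by (simp add: cmat_def bracket_def differential_def)

text \<open>Real involution only concerns real parameters. Non-real ones are reached because the
  bracket depends linearly on the bivector and vanishes for \<open>A\<close> and \<open>B\<close>
  separately.\<close>

lemma bracket_pencil_cmat:
  assumes A: "bracket c A f g x = 0" and B: "bracket c B f g x = 0"
  shows "(\<Sum>k\<in>UNIV. \<Sum>m\<in>UNIV. pencil (cmat A) (cmat B) l c x $ k $ m
    * complex_of_real (differential c f x $ k) * complex_of_real (differential c g x $ m)) = 0"
proof (cases l)
  case None
  then show ?thesis
    using B sum_bracket_cmat[of B c x f g] by (simp add: pencil_def)
next
  case (Some t)
  have "pencil (cmat A) (cmat B) l c x $ k $ m * a * b
      = cmat A c x $ k $ m * a * b + t * (cmat B c x $ k $ m * a * b)" for k m a b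
    by (simp add: Some pencil_def lin_comb_def algebra_simps)
  then show ?thesis
    using A B by (simp add: sum.distrib sum_distrib_left[symmetric] sum_bracket_cmat)
qed

lemma wedge_complexification:
  "wedge N (\<lambda>i. \<chi> k. complex_of_real (\<alpha> i $ k)) (\<lambda>i. \<chi> k. complex_of_real (X i $ k))
    = complex_of_real (wedge N \<alpha> X)"
  by (simp add: wedge_def)

text \<open>Generic attainment of the rank supplies a real parameter at a generic point, and
  complexification does not lower the rank; the isotropy argument is then carried out over the
  complex numbers.\<close>

lemma generically_in_image_real:
  fixes M :: "'m topology" and \<Phi> :: "('m, real, 'n::finite) chart set"
  assumes M: "manifold M \<Phi>" and AB: "compatible_poisson M \<Phi> A B"
    and rk: "rank_attained_generically M \<Phi> A B" and bi: "locally_bi_integrable M \<Phi> A B v"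
  shows "generically (prod_topology riemann_sphere M)
    (\<lambda>(l, x). in_image \<Phi> (cvec v) (pencil (cmat A) (cmat B) l) x)"
proof (rule generically_in_image[where r = "pencil_rank \<Phi> A B"])
  note A = compatible_poissonD(1)[OF AB] and B = compatible_poissonD(2)[OF AB]
  have chart: "is_chart M c" if "c \<in> \<Phi>" for c
    using M that by (simp add: manifold_def)
  then show "openin M (fst c)" if "c \<in> \<Phi>" for c
    using that is_chart_openin by blast
  show "(\<Union>c\<in>\<Phi>. fst c) = topspace M"
    using M by (simp add: manifold_def)
  have cont: "continuous_map (subtopology M (fst c)) euclidean (\<lambda>x. cmat P c x $ i $ j)"
    if P: "bivector_field \<Phi> P" and c: "c \<in> \<Phi>" for P c i j
  proof -
    have "continuous_map (subtopology M (fst c)) euclidean (\<lambda>x. P c x $ i $ j)"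
      using chart[OF c] bivector_field_smooth[OF P c] by (rule continuous_map_if_smooth_in_chart)
    then show ?thesis
      unfolding continuous_map_atin limitin_canonical_iff cmat_def by (auto intro: tendsto_of_real)
  qed
  show "continuous_map (subtopology M (fst c)) euclidean (\<lambda>x. cmat A c x $ i $ j)"
    "continuous_map (subtopology M (fst c)) euclidean (\<lambda>x. cmat B c x $ i $ j)" if "c \<in> \<Phi>" for c i j
    using that A B by (simp_all add: cont)
  show "\<exists>J. cmat A d x = J ** cmat A c x ** transpose J \<and> cmat B d x = J ** cmat B c x ** transpose J"
    if cd: "c \<in> \<Phi>" "d \<in> \<Phi>" "x \<in> fst c \<inter> fst d" for c d x
  proof -
    let ?J = "jacobian c d x"
    let ?K = "\<chi> i j. complex_of_real (?J $ i $ j)"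
    have "cmat P d x = ?K ** cmat P c x ** transpose ?K" if P: "bivector_field \<Phi> P" for P
      unfolding cmat_def bivector_field_transform[OF P cd]
      by (simp add: vec_eq_iff matrix_matrix_mult_def transpose_def)
    then show ?thesis
      using A B by blast
  qed
  define N where "N = CARD('n) - pencil_rank \<Phi> A B div 2"
  show "generically M (\<lambda>x. \<forall>c\<in>\<Phi>. x \<in> fst c \<longrightarrow>
      (\<exists>l. pencil_rank \<Phi> A B \<le> rank (pencil (cmat A) (cmat B) l c x)) \<and>
      (\<forall>l. pencil_rank \<Phi> A B \<le> rank (pencil (cmat A) (cmat B) l c x) \<longrightarrow>
        cvec v c x \<in> range ((*v) (pencil (cmat A) (cmat B) l c x))))"
  proof (rule generically_mono[OF generically_conj[OF rk[unfolded rank_attained_generically_def]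
          generically_isotropic_differentials[OF bi N_def]]], elim conjE exE, intro ballI impI conjI allI)
    fix x l h c
    assume l: "\<forall>c\<in>\<Phi>. x \<in> fst c \<longrightarrow> rank (pencil A B l c x) = pencil_rank \<Phi> A B"
      and h: "\<forall>c\<in>\<Phi>. x \<in> fst c \<longrightarrow>
        wedge N (\<lambda>i. differential c (h i) x) \<noteq> (\<lambda>X. 0) \<and>
        (\<forall>i<N. (\<Sum>k\<in>UNIV. v c x $ k * partial c k (h i) x) = 0) \<and>
        (\<forall>i<N. \<forall>j<N. \<forall>l. bracket c (pencil A B l) (h i) (h j) x = 0)"
      and c: "c \<in> \<Phi>" "x \<in> fst c"
    \<comment> \<open>The real parameter is regarded as a complex one, with infinity kept fixed by
      \<open>map_option\<close>.\<close>
    have "(\<chi> i j. complex_of_real (pencil A B l c x $ i $ j))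
        = pencil (cmat A) (cmat B) (map_option complex_of_real l) c x"
      by (cases l) (simp_all add: pencil_def lin_comb_def cmat_def vec_eq_iff)
    then have "pencil_rank \<Phi> A B \<le> rank (pencil (cmat A) (cmat B) (map_option complex_of_real l) c x)"
      using rank_le_rank_complexification[of "pencil A B l c x"] l c by simp
    then show "\<exists>l. pencil_rank \<Phi> A B \<le> rank (pencil (cmat A) (cmat B) l c x)" ..
    fix l'
    let ?P = "pencil (cmat A) (cmat B) l' c x"
    assume r: "pencil_rank \<Phi> A B \<le> rank ?P"
    let ?\<alpha> = "\<lambda>i. \<chi> k. complex_of_real (differential c (h i) x $ k)"
    have "wedge N (\<lambda>i. differential c (h i) x) \<noteq> (\<lambda>X. 0)"
      using h c by blast
    then obtain X where X: "wedge N (\<lambda>i. differential c (h i) x) X \<noteq> 0"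
      unfolding fun_eq_iff by blast
    have br: "bracket c A (h i) (h j) x = 0" "bracket c B (h i) (h j) x = 0" if "i < N" "j < N" for i j
    proof -
      have "bracket c (pencil A B l) (h i) (h j) x = 0" for l
        using h c that by blast
      \<comment> \<open>The parameters 0 and infinity recover \<open>A\<close> and
        \<open>B\<close>.\<close>
      from this[of "Some 0"] this[of None]
      show "bracket c A (h i) (h j) x = 0" "bracket c B (h i) (h j) x = 0"
        by (simp_all add: pencil_def bracket_def lin_comb_def)
    qed
    show "cvec v c x \<in> range ((*v) ?P)"
    proof (rule in_range_if_annihilated_by_isotropic)
      show "?P $ i $ j = - ?P $ j $ i" for i j
      proof (rule pencil_skew)
        show "cmat A c x $ i $ j = - cmat A c x $ j $ i" for i j
          using bivector_field_skew[OF A c, of i j] by (simp add: cmat_def)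
        show "cmat B c x $ i $ j = - cmat B c x $ j $ i" for i j
          using bivector_field_skew[OF B c, of i j] by (simp add: cmat_def)
      qed
      show "wedge N ?\<alpha> (\<lambda>i. \<chi> k. complex_of_real (X i $ k)) \<noteq> 0"
        unfolding wedge_complexification using X by simp
      show "(\<Sum>k\<in>UNIV. \<Sum>m\<in>UNIV. ?P $ k $ m * ?\<alpha> i $ k * ?\<alpha> j $ m) = 0" if "i < N" "j < N" for i j
        using bracket_pencil_cmat[OF br[OF that]] by simp
      show "(\<Sum>k\<in>UNIV. cvec v c x $ k * ?\<alpha> i $ k) = 0" if "i < N" for i
      proof -
        have "(\<Sum>k\<in>UNIV. cvec v c x $ k * ?\<alpha> i $ k)
            = complex_of_real (\<Sum>k\<in>UNIV. v c x $ k * partial c k (h i) x)"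
          by (simp add: cvec_def differential_def)
        then show ?thesis
          using h c that by simp
      qed
      \<comment> \<open>Truncated subtraction and the rounding in \<open>div\<close> can only
        enlarge \<open>N\<close>, so the bound follows without the parity of the rank.\<close>
      show "2 * CARD('n) \<le> 2 * N + rank ?P"
        using r by (simp add: N_def)
    qed
  qed
qed

text \<open>On a connected manifold a single parameter \<open>l0\<close> at which the maximal rank
  occurs serves for generic \<open>x\<close>, by the identity theorem for the one bivector
  \<open>pencil A B l0\<close>.\<close>

lemma generically_in_image_complex:
  fixes M :: "'m topology" and \<Phi> :: "('m, complex, 'n::finite) chart set"
  assumes M: "manifold M \<Phi>" "connected_space M" and AB: "compatible_poisson M \<Phi> A B"
    and bi: "locally_bi_integrable M \<Phi> A B v"
  shows "generically (prod_topology riemann_sphere M) (\<lambda>(l, x). in_image \<Phi> v (pencil A B l) x)"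
\<comment> \<open>On the empty manifold there is no point to attain the maximum defining the rank,
  and the claim is vacuous.\<close>
proof (cases "topspace M = {}")
  case True
  then show ?thesis
    by (intro generically_if_topspace_empty) simp
next
  case False
  note A = compatible_poissonD(1)[OF AB] and B = compatible_poissonD(2)[OF AB]
  have chart: "is_chart M c" if "c \<in> \<Phi>" for c
    using M(1) that by (simp add: manifold_def)
  have cover: "(\<Union>c\<in>\<Phi>. fst c) = topspace M"
    using M(1) by (simp add: manifold_def)
  obtain c x where "c \<in> \<Phi>" "x \<in> fst c"
    using False cover by blast
  then obtain l0 c0 x0 where "c0 \<in> \<Phi>" "x0 \<in> fst c0" "rank (pencil A B l0 c0 x0) = pencil_rank \<Phi> A B"
    by (rule pencil_rank_attained)
  then have rk: "generically M (\<lambda>x. \<forall>c\<in>\<Phi>. x \<in> fst c \<longrightarrow> pencil_rank \<Phi> A B \<le> rank (pencil A B l0 c x))"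
    using rank_ge_generically[OF M compatible_poisson_pencil[OF AB]] by simp
  define N where "N = CARD('n) - pencil_rank \<Phi> A B div 2"
  show ?thesis
  proof (rule generically_in_image[where r = "pencil_rank \<Phi> A B"])
    show "openin M (fst c)" if "c \<in> \<Phi>" for c
      using chart[OF that] by (rule is_chart_openin)
    show "(\<Union>c\<in>\<Phi>. fst c) = topspace M"
      by (rule cover)
    show "continuous_map (subtopology M (fst c)) euclidean (\<lambda>x. A c x $ i $ j)" if "c \<in> \<Phi>" for c i j
      using chart[OF that] bivector_field_smooth[OF A that] by (rule continuous_map_if_smooth_in_chart)
    show "continuous_map (subtopology M (fst c)) euclidean (\<lambda>x. B c x $ i $ j)" if "c \<in> \<Phi>" for c i j
      using chart[OF that] bivector_field_smooth[OF B that] by (rule continuous_map_if_smooth_in_chart)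
    show "\<exists>J. A d x = J ** A c x ** transpose J \<and> B d x = J ** B c x ** transpose J"
      if cd: "c \<in> \<Phi>" "d \<in> \<Phi>" "x \<in> fst c \<inter> fst d" for c d x
      using bivector_field_transform[OF A cd] bivector_field_transform[OF B cd] by (intro exI conjI)
    show "generically M (\<lambda>x. \<forall>c\<in>\<Phi>. x \<in> fst c \<longrightarrow>
        (\<exists>l. pencil_rank \<Phi> A B \<le> rank (pencil A B l c x)) \<and>
        (\<forall>l. pencil_rank \<Phi> A B \<le> rank (pencil A B l c x) \<longrightarrow> v c x \<in> range ((*v) (pencil A B l c x))))"
    proof (rule generically_mono[OF generically_conj[OF rk
            generically_isotropic_differentials[OF bi N_def]]], elim conjE exE, intro ballI impI conjI allI)
      fix x h c
      assume l0: "\<forall>c\<in>\<Phi>. x \<in> fst c \<longrightarrow> pencil_rank \<Phi> A B \<le> rank (pencil A B l0 c x)"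
        and h: "\<forall>c\<in>\<Phi>. x \<in> fst c \<longrightarrow>
          wedge N (\<lambda>i. differential c (h i) x) \<noteq> (\<lambda>X. 0) \<and>
          (\<forall>i<N. (\<Sum>k\<in>UNIV. v c x $ k * partial c k (h i) x) = 0) \<and>
          (\<forall>i<N. \<forall>j<N. \<forall>l. bracket c (pencil A B l) (h i) (h j) x = 0)"
        and c: "c \<in> \<Phi>" "x \<in> fst c"
      show "\<exists>l. pencil_rank \<Phi> A B \<le> rank (pencil A B l c x)"
        using l0 c by blast
      fix l
      assume r: "pencil_rank \<Phi> A B \<le> rank (pencil A B l c x)"
      have "wedge N (\<lambda>i. differential c (h i) x) \<noteq> (\<lambda>X. 0)"
        using h c by blast
      then obtain X where X: "wedge N (\<lambda>i. differential c (h i) x) X \<noteq> 0"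
        unfolding fun_eq_iff by blast
      show "v c x \<in> range ((*v) (pencil A B l c x))"
      proof (rule in_range_if_annihilated_by_isotropic[OF _ X])
        show "pencil A B l c x $ i $ j = - pencil A B l c x $ j $ i" for i j
          using bivector_field_skew[OF A c] bivector_field_skew[OF B c] by (rule pencil_skew)
        show "(\<Sum>k\<in>UNIV. \<Sum>m\<in>UNIV. pencil A B l c x $ k $ m * differential c (h i) x $ k
            * differential c (h j) x $ m) = 0" if "i < N" "j < N" for i j
        proof -
          have "bracket c (pencil A B l) (h i) (h j) x = 0"
            using h c that by blast
          then show ?thesis
            by (simp add: bracket_def differential_def)
        qed
        show "(\<Sum>k\<in>UNIV. v c x $ k * differential c (h i) x $ k) = 0" if "i < N" for i
          using h c that by (simp add: differential_def)
        show "2 * CARD('n) \<le> 2 * N + rank (pencil A B l c x)"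
          using r by (simp add: N_def)
      qed
    qed
  qed
qed

theorem lemma1p1:
  shows
   "(\<forall>(M :: 'm topology) (\<Phi> :: ('m, real, 'n::finite) chart set) A B v f g.
       manifold M \<Phi> \<and> compatible_poisson M \<Phi> A B \<and> vector_field \<Phi> v \<and>
       smooth_fun \<Phi> (topspace M) f \<and> smooth_fun \<Phi> (topspace M) g \<and>
       hamiltonian_field \<Phi> A f v \<and> hamiltonian_field \<Phi> B g v \<and>
       rank_attained_generically M \<Phi> A B \<and>
       locally_bi_integrable M \<Phi> A B v
       \<longrightarrow> generically (prod_topology riemann_sphere M)
             (\<lambda>(l, x). in_image \<Phi> (cvec v) (pencil (cmat A) (cmat B) l) x))
    \<and>
    (\<forall>(M :: 'm topology) (\<Phi> :: ('m, complex, 'n::finite) chart set) A B v f g.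
       manifold M \<Phi> \<and> connected_space M \<and> compatible_poisson M \<Phi> A B \<and> vector_field \<Phi> v \<and>
       smooth_fun \<Phi> (topspace M) f \<and> smooth_fun \<Phi> (topspace M) g \<and>
       hamiltonian_field \<Phi> A f v \<and> hamiltonian_field \<Phi> B g v \<and>
       locally_bi_integrable M \<Phi> A B v
       \<longrightarrow> generically (prod_topology riemann_sphere M)
             (\<lambda>(l, x). in_image \<Phi> v (pencil A B l) x))"
  using generically_in_image_real generically_in_image_complex by blast

end
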